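(* For all integers $n\ge 0$ and $k\ge 0$, $$b_{3,5,8}\!\left(16\cdot 5^{2k+1}n+\frac{26\cdot 5^{2k+1}+23}{3}\right)\equiv b_{3,5,8}(80n+51)\pmod 2.$$
   Context: For $|q|<1$ and a positive integer $i$, $f_i := (q^i;q^i)_\infty = \prod_{m=1}^{\infty}(1-q^{im})$. The integers $b_{3,5,8}(n)$, $n\ge 0$, are defined by the generating function $$\sum_{n=0}^{\infty} b_{3,5,8}(n)q^n = \frac{f_3f_5f_8}{f_1f_{15}f_{24}f_{40}f_{120}} ,$$ which is the case $(\ell,k,r)=(3,5,8)$ of $\sum_{n\ge 0} b_{\ell,k,r}(n)q^n=\dfrac{f_\ell f_kf_r}{f_1f_{\ell k}f_{\ell r}f_{kr}f_{\ell kr}}$. *)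

theory Defs
  imports "HOL-Complex_Analysis.Complex_Analysis" "HOL-Number_Theory.Cong"
begin

definition f_prod :: "nat \<Rightarrow> complex \<Rightarrow> complex" where
  "f_prod i q = (\<Prod>m. 1 - q ^ (i * Suc m))"

definition b_gen :: "nat \<Rightarrow> nat \<Rightarrow> nat \<Rightarrow> complex \<Rightarrow> complex" where
  "b_gen l k r q =
     f_prod l q * f_prod k q * f_prod r q /
     (f_prod 1 q * f_prod (l * k) q * f_prod (l * r) q * f_prod (k * r) q * f_prod (l * k * r) q)"

text \<open>The description below determines a unique integer sequence for positive
  \<open>l\<close>, \<open>k\<close>, \<open>r\<close>; see \<open>b_gen_expansion\<close> and \<open>b_coeff_sums\<close> below.\<close>

definition b_coeff :: "nat \<Rightarrow> nat \<Rightarrow> nat \<Rightarrow> nat \<Rightarrow> int" where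
  "b_coeff l k r = (THE c. \<forall>q. norm q < 1 \<longrightarrow> (\<lambda>n. of_int (c n) * q ^ n) sums b_gen l k r q)"

definition int_expansion :: "(complex \<Rightarrow> complex) \<Rightarrow> bool" where
  "int_expansion g \<longleftrightarrow> g holomorphic_on ball 0 1 \<and> g 0 = 1 \<and> (\<forall>z\<in>ball 0 1. g z \<noteq> 0) \<and>
     (\<forall>n. (deriv ^^ n) g 0 / fact n \<in> \<int>)"

lemma int_expansion_fps:
  assumes "int_expansion g"
  shows "g has_fps_expansion fps_expansion g 0" "fps_nth (fps_expansion g 0) n \<in> \<int>"
    "fps_nth (fps_expansion g 0) 0 = 1"
proof -
  show "g has_fps_expansion fps_expansion g 0"
    using assms by (intro has_fps_expansion_fps_expansion[of "ball 0 1"]) (auto simp: int_expansion_def)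
  show "fps_nth (fps_expansion g 0) n \<in> \<int>" "fps_nth (fps_expansion g 0) 0 = 1"
    using assms by (auto simp: int_expansion_def fps_expansion_def)
qed

lemma int_expansion_mult:
  assumes "int_expansion g" "int_expansion h"
  shows "int_expansion (\<lambda>z. g z * h z)"
proof -
  have "(\<lambda>z. g z * h z) has_fps_expansion fps_expansion g 0 * fps_expansion h 0"
    using assms by (intro has_fps_expansion_mult int_expansion_fps)
  from fps_nth_fps_expansion[OF this, symmetric]
  have "(deriv ^^ n) (\<lambda>z. g z * h z) 0 / fact n \<in> \<int>" for n
    using int_expansion_fps(2)[OF assms(1)] int_expansion_fps(2)[OF assms(2)]
    by (auto simp: fps_mult_nth intro!: Ints_sum Ints_mult)
  thus ?thesis using assms by (auto simp: int_expansion_def intro!: holomorphic_intros)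
qed

lemma int_expansion_inverse:
  assumes "int_expansion g"
  shows "int_expansion (\<lambda>z. inverse (g z))"
proof -
  define G where "G = fps_expansion g 0"
  have G: "g has_fps_expansion G" "\<And>n. fps_nth G n \<in> \<int>" "fps_nth G 0 = 1"
    using int_expansion_fps[OF assms] by (auto simp: G_def)
  have int: "fps_nth (inverse G) n \<in> \<int>" for n
  proof (induction n rule: less_induct)
    case (less n)
    show ?case
    proof (cases "n = 0")
      case False
      have "fps_nth (inverse G) n = - (\<Sum>i=1..n. fps_nth G i * fps_nth (inverse G) (n - i))"
        using False G(3) fps_right_inverse_constructor_rec[of n G 1]
        by (simp add: fps_inverse_def)
      also have "\<dots> \<in> \<int>"
        using False by (intro Ints_minus Ints_sum Ints_mult G(2) less.IH) auto
      finally show ?thesis .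
    qed (use G in auto)
  qed
  have "(\<lambda>z. inverse (g z)) has_fps_expansion inverse G"
    using G by (intro has_fps_expansion_inverse) auto
  from fps_nth_fps_expansion[OF this, symmetric] int
  have "(deriv ^^ n) (\<lambda>z. inverse (g z)) 0 / fact n \<in> \<int>" for n
    by auto
  thus ?thesis using assms by (auto simp: int_expansion_def intro!: holomorphic_intros)
qed

lemma int_expansion_factor:
  assumes "j > 0"
  shows "int_expansion (\<lambda>z. 1 - z ^ j)"
proof -
  have "(\<lambda>z::complex. 1 - z ^ j) has_fps_expansion 1 - fps_X ^ j"
    by (intro fps_expansion_intros)
  from fps_nth_fps_expansion[OF this, symmetric]
  have "(deriv ^^ n) (\<lambda>z::complex. 1 - z ^ j) 0 / fact n \<in> \<int>" for n
    by (auto simp: fps_X_power_nth)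
  moreover have "1 - z ^ j \<noteq> 0" if "norm z < 1" for z :: complex
    using power_less_one_iff[of "norm z" j] that assms by (auto simp flip: norm_power)
  ultimately show ?thesis using assms
    by (auto simp: int_expansion_def intro!: holomorphic_intros)
qed

lemma int_expansion_prod:
  assumes "\<And>m. int_expansion (g m)"
  shows "int_expansion (\<lambda>z. \<Prod>m<(N::nat). g m z)"
proof (induction N)
  case 0
  have "(\<lambda>z::complex. 1) has_fps_expansion 1" by simp
  from fps_nth_fps_expansion[OF this, symmetric] show ?case by (auto simp: int_expansion_def)
next
  case (Suc N)
  thus ?case using assms by (simp add: int_expansion_mult)
qed

lemma le_mult_Suc: "0 < i \<Longrightarrow> m \<le> i * Suc m" for i m :: nat
  by (metis One_nat_def Suc_leD less_eq_Suc_le mult_le_cancel2 nat_mult_1)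

lemma f_prod_convergent:
  assumes "i > 0" "norm q < 1"
  shows "convergent_prod (\<lambda>m. 1 - q ^ (i * Suc m) :: complex)"
proof -
  have "norm q ^ (i * Suc m) \<le> norm q ^ m" for m
    using assms by (intro power_decreasing) (auto intro!: le_mult_Suc simp del: mult_Suc_right)
  hence "summable (\<lambda>m. norm ((1 - q ^ (i * Suc m)) - 1))"
    using assms by (intro summable_comparison_test'[OF summable_geometric[of "norm q"]])
      (auto simp: norm_power norm_mult simp del: mult_Suc_right)
  thus ?thesis
    by (intro abs_convergent_prod_imp_convergent_prod summable_imp_abs_convergent_prod)
qed

lemma f_prod_uniform_limit:
  assumes "i > 0" "0 < R" "R < 1"
  shows "uniform_limit (cball 0 R) (\<lambda>N q. \<Prod>m<N. 1 - q ^ (i * Suc m)) (f_prod i) sequentially"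
proof -
  have "uniformly_convergent_on (cball 0 R) (\<lambda>N q. \<Prod>m<N. 1 - q ^ (i * Suc m) :: complex)"
  proof (rule uniformly_convergent_on_prod')
    show "uniformly_convergent_on (cball 0 R) (\<lambda>N q. \<Sum>m<N. norm (1 - q ^ (i * Suc m) - 1 :: complex))"
    proof (rule Weierstrass_m_test')
      fix m and q :: complex assume q: "q \<in> cball 0 R"
      have "norm q ^ (i * Suc m) \<le> norm q ^ m"
        using assms q by (intro power_decreasing) (auto intro!: le_mult_Suc simp del: mult_Suc_right)
      also have "\<dots> \<le> R ^ m" using q by (intro power_mono) auto
      finally show "norm (norm (1 - q ^ (i * Suc m) - 1 :: complex)) \<le> R ^ m"
        by (simp add: norm_power norm_mult del: mult_Suc_right)
    qed (use assms in auto)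
  qed (auto intro!: continuous_intros)
  then obtain g :: "complex \<Rightarrow> complex"
    where g: "uniform_limit (cball 0 R) (\<lambda>N q. \<Prod>m<N. 1 - q ^ (i * Suc m)) g sequentially"
    unfolding uniformly_convergent_on_def by blast
  also have "?this \<longleftrightarrow> ?thesis"
  proof (intro uniform_limit_cong)
    fix q :: complex assume q: "q \<in> cball 0 R"
    have "(\<lambda>N. \<Prod>m<Suc N. 1 - q ^ (i * Suc m)) \<longlonglongrightarrow> g q"
      using tendsto_uniform_limitI[OF g q] by (subst filterlim_sequentially_Suc)
    moreover have "(\<lambda>N. \<Prod>m<Suc N. 1 - q ^ (i * Suc m)) \<longlonglongrightarrow> f_prod i q"
      using convergent_prod_LIMSEQ[OF f_prod_convergent[of i q]] q assms
      by (simp only: lessThan_Suc_atMost f_prod_def) auto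
    ultimately show "g q = f_prod i q" by (rule LIMSEQ_unique)
  qed auto
  finally show ?thesis .
qed

lemma int_expansion_f_prod:
  assumes "i > 0"
  shows "int_expansion (f_prod i)"
proof -
  let ?P = "\<lambda>N q. \<Prod>m<N. 1 - q ^ (i * Suc m) :: complex"
  have P: "int_expansion (?P N)" for N
    by (intro int_expansion_prod int_expansion_factor) (use assms in auto)
  have hol: "f_prod i holomorphic_on ball 0 1"
  proof (rule holomorphic_uniform_sequence)
    fix x :: complex assume x: "x \<in> ball 0 1"
    define R where "R = (1 + norm x) / 2"
    have R: "0 < R" "R < 1" and "norm x < R"
      using x add_pos_nonneg[of 1 "norm x"] by (simp_all add: R_def)
    hence "x \<in> ball 0 R" by simp
    then obtain d where d: "d > 0" "cball x d \<subseteq> ball 0 R"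
      using open_contains_cball[of "ball 0 R"] open_ball by blast
    have "uniform_limit (cball x d) ?P (f_prod i) sequentially"
      by (rule uniform_limit_on_subset[OF f_prod_uniform_limit[OF assms R]])
         (rule order_trans[OF d(2) ball_subset_cball])
    moreover have "cball x d \<subseteq> ball 0 1"
      using d(2) subset_ball[of R 1 0] R(2) by (meson less_imp_le order_trans)
    ultimately show "\<exists>d>0. cball x d \<subseteq> ball 0 1 \<and> uniform_limit (cball x d) ?P (f_prod i) sequentially"
      using d(1) by (intro exI[of _ d] conjI)
  qed (auto intro!: holomorphic_intros)
  have int: "(deriv ^^ n) (f_prod i) 0 / fact n \<in> \<int>" for n
  proof -
    have "uniform_limit (ball 0 (1/2)) ?P (f_prod i) sequentially"
      by (rule uniform_limit_on_subset[OF f_prod_uniform_limit[of i "1/2"]]) (use assms in auto)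
    hence "(\<lambda>N. (deriv ^^ n) (?P N) 0) \<longlonglongrightarrow> (deriv ^^ n) (f_prod i) 0"
    proof (rule higher_deriv_complex_uniform_limit)
      show "\<forall>\<^sub>F N in sequentially. ?P N holomorphic_on ball 0 (1/2)"
        by (intro always_eventually allI holomorphic_intros)
    qed auto
    hence "(\<lambda>N. (deriv ^^ n) (?P N) 0 / fact n) \<longlonglongrightarrow> (deriv ^^ n) (f_prod i) 0 / fact n"
      by (rule tendsto_divide[OF _ tendsto_const]) simp
    moreover have "(deriv ^^ n) (?P N) 0 / fact n \<in> \<int>" for N
      using P[of N] unfolding int_expansion_def by simp
    ultimately show ?thesis
      by (rule closed_sequentially[OF closed_Ints, rotated])
  qed
  have nz: "f_prod i z \<noteq> 0" if "z \<in> ball 0 1" for z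
    unfolding f_prod_def
  proof (rule prodinf_nonzero)
    show "1 - z ^ (i * Suc m) \<noteq> 0" for m
      using int_expansion_factor[of "i * Suc m"] assms that unfolding int_expansion_def by simp
    show "convergent_prod (\<lambda>m. 1 - z ^ (i * Suc m))"
      using f_prod_convergent[OF assms, of z] that by simp
  qed
  have "(0 :: complex) ^ (i * Suc m) = 0" for m
    by (rule zero_power) (use assms in simp)
  hence "f_prod i 0 = 1" unfolding f_prod_def by (simp only: diff_zero prodinf_zero)
  thus ?thesis using hol int nz unfolding int_expansion_def by blast
qed

lemma b_gen_expansion:
  assumes "l > 0" "k > 0" "r > 0"
  shows "\<exists>!c :: nat \<Rightarrow> int. \<forall>q. norm q < 1 \<longrightarrow> (\<lambda>n. of_int (c n) * q ^ n) sums b_gen l k r q"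
proof (rule ex_ex1I)
  have "int_expansion (b_gen l k r)"
    unfolding b_gen_def divide_inverse using assms
    by (intro int_expansion_mult int_expansion_inverse int_expansion_f_prod) auto
  hence hol: "b_gen l k r holomorphic_on ball 0 1" and
    int: "\<forall>n. \<exists>c. (deriv ^^ n) (b_gen l k r) 0 / fact n = of_int c"
    unfolding int_expansion_def Ints_def by blast+
  from int obtain c :: "nat \<Rightarrow> int" where c: "\<And>n. (deriv ^^ n) (b_gen l k r) 0 / fact n = of_int (c n)"
    by metis
  have "\<forall>q. norm q < 1 \<longrightarrow> (\<lambda>n. of_int (c n) * q ^ n) sums b_gen l k r q"
    using holomorphic_power_series[OF hol] by (simp add: c)
  thus "\<exists>c :: nat \<Rightarrow> int. \<forall>q. norm q < 1 \<longrightarrow> (\<lambda>n. of_int (c n) * q ^ n) sums b_gen l k r q"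
    by (rule exI[of _ c])
next
  fix c d :: "nat \<Rightarrow> int"
  assume c: "\<forall>q. norm q < 1 \<longrightarrow> (\<lambda>n. of_int (c n) * q ^ n) sums b_gen l k r q"
     and d: "\<forall>q. norm q < 1 \<longrightarrow> (\<lambda>n. of_int (d n) * q ^ n) sums b_gen l k r q"
  have exp: "b_gen l k r has_fps_expansion Abs_fps (\<lambda>n. of_int (c n))"
    if "\<forall>q. norm q < 1 \<longrightarrow> (\<lambda>n. of_int (c n) * q ^ n) sums b_gen l k r q" for c :: "nat \<Rightarrow> int"
    by (rule has_fps_expansionI)
      (use that in \<open>auto simp: eventually_nhds_metric intro!: exI[of _ 1]\<close>)
  have "of_int (c n) = (of_int (d n) :: complex)" for n
    using fps_nth_fps_expansion[OF exp[OF c], of n] fps_nth_fps_expansion[OF exp[OF d], of n] by simp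
  thus "c = d" by auto
qed

lemma b_coeff_sums:
  assumes "l > 0" "k > 0" "r > 0" "norm q < 1"
  shows "(\<lambda>n. of_int (b_coeff l k r n) * q ^ n) sums b_gen l k r q"
  using theI'[OF b_gen_expansion[OF assms(1-3)]] assms(4) unfolding b_coeff_def by blast

text \<open>Hence \<open>div\<close> is exact in \<open>(26 * 5 ^ (2 * k + 1) + 23) div 3\<close>.\<close>

lemma three_dvd: "3 dvd 26 * 5 ^ (2 * k + 1) + (23 :: nat)"
proof (induction k)
  case (Suc k)
  have "26 * 5 ^ (2 * Suc k + 1) + 23 = (26 * 5 ^ (2 * k + 1) + 23) + 3 * (208 * 5 ^ (2 * k + 1) :: nat)"
    by simp
  thus ?case using Suc by (metis dvd_add dvd_triv_left)
qed simp

end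

theory Submission
  imports Defs "HOL-Library.Z2" "HOL-Library.Nat_Bijection"
begin

text \<open>
  Write \<open>f\<^sub>i\<close> for the Euler products over the field with two elements, where \<open>f\<^sub>2\<^sub>i = f\<^sub>i\<^sup>2\<close>. There the
  generating function is \<open>(f\<^sub>3 f\<^sub>5 / (f\<^sub>1 f\<^sub>1\<^sub>5)) (f\<^sub>1 / (f\<^sub>3 f\<^sub>5 f\<^sub>1\<^sub>5))\<^sup>8\<close>, and four successive \<open>2\<close>-dissections
  show that the terms with index \<open>16 n + 3\<close> are generated by \<open>q f\<^sub>2 f\<^sub>1\<^sub>5\<close>. These dissections need the
  odd part of \<open>f\<^sub>1 f\<^sub>3 f\<^sub>5 f\<^sub>1\<^sub>5\<close> and the terms of \<open>f\<^sub>3 f\<^sub>5\<close> with index \<open>4 n + 1\<close>. By the pentagonal number theorem a product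
  \<open>f\<^sub>i f\<^sub>j\<close> counts solutions of \<open>i x\<^sup>2 + j y\<^sup>2 = 24 n + i + j\<close> modulo \<open>2\<close>, so they follow by transforming
  binary quadratic forms of discriminants \<open>-12\<close>, \<open>-20\<close> and \<open>-60\<close> and cancelling solutions in pairs.
  Finally \<open>2 x\<^sup>2 + 15 y\<^sup>2 = 24 (5 n + 2) + 17\<close> forces \<open>5 | x\<close>, so the terms with index \<open>80 n + 51\<close> are
  generated by \<open>f\<^sub>3 f\<^sub>1\<^sub>0\<close>, and \<open>3 x\<^sup>2 + 10 y\<^sup>2 = 25 (24 n + 13)\<close> forces \<open>x\<close> and \<open>y\<close> to be multiples of \<open>5\<close>,
  whence the invariance under \<open>n \<mapsto> 25 n + 13\<close>.
\<close>

section \<open>Binary quadratic forms modulo \<open>2\<close>\<close>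

declare add_bit_eq_xor [simp del] mult_bit_eq_and [simp del]

text \<open>The points moved by \<open>g\<close> fall into pairs \<open>{x, g x}\<close>, which
  vanish modulo 2.\<close>

lemma of_nat_card_involution:
  assumes "finite S" and "\<And>x. x \<in> S \<Longrightarrow> g x \<in> S" and "\<And>x. x \<in> S \<Longrightarrow> g (g x) = x"
  shows "(of_nat (card S) :: bit) = of_nat (card {x \<in> S. g x = x})"
proof -
  have "(\<Sum>x \<in> {x \<in> S. g x \<noteq> x}. 1 :: bit) = 0"
    by (rule sum_involution_eq_0[where h = g]) (use assms(2,3) in force)+
  moreover have "card S = card {x \<in> S. g x = x} + card {x \<in> S. g x \<noteq> x}"
    using assms(1) by (subst card_Un_disjoint[symmetric]) (auto intro: arg_cong[where f = card])
  ultimately show ?thesis by simp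
qed

text \<open>For maps known to be free involutions only outside \<open>D\<close>: extended by the
  identity on \<open>D\<close>, they have exactly \<open>D\<close> as fixed points.\<close>

lemma of_nat_card_involution_off:
  assumes "finite S" "D \<subseteq> S" and "\<And>x. x \<in> S - D \<Longrightarrow> g x \<in> S - D \<and> g (g x) = x \<and> g x \<noteq> x"
  shows "(of_nat (card S) :: bit) = of_nat (card D)"
proof -
  define h where "h x = (if x \<in> D then x else g x)" for x
  have "(of_nat (card S) :: bit) = of_nat (card {x \<in> S. h x = x})"
    by (rule of_nat_card_involution) (use assms in \<open>auto simp: h_def\<close>)
  also have "{x \<in> S. h x = x} = D"
    using assms(2,3) by (auto simp: h_def)
  finally show ?thesis .
qed

lemma abs_le_square: "\<bar>x\<bar> \<le> x\<^sup>2" for x :: int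
  using self_le_power[of "\<bar>x\<bar>" 2] by (cases "x = 0") auto

lemma finite_int_square_eq: "finite {x :: int. x\<^sup>2 = c}"
proof (rule finite_subset)
  show "{x. x\<^sup>2 = c} \<subseteq> {- c..c}"
  proof
    fix x assume "x \<in> {x. x\<^sup>2 = c}"
    then have "\<bar>x\<bar> \<le> c" using abs_le_square[of x] by simp
    then show "x \<in> {- c..c}" by auto
  qed
qed simp

lemma finite_binary_form:
  fixes a b M :: int
  assumes "a > 0" "b > 0"
  shows "finite {(x, y). a * x\<^sup>2 + b * y\<^sup>2 = M}"
proof (rule finite_subset)
  have *: "\<bar>z\<bar> \<le> M" if "c * z\<^sup>2 \<le> M" "c > 0" for c z :: int
  proof -
    have "\<bar>z\<bar> \<le> 1 * z\<^sup>2" using abs_le_square by simp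
    also have "\<dots> \<le> c * z\<^sup>2" using that(2) by (intro mult_right_mono) auto
    finally show ?thesis using that(1) by simp
  qed
  show "{(x, y). a * x\<^sup>2 + b * y\<^sup>2 = M} \<subseteq> {- M..M} \<times> {- M..M}"
  proof safe
    fix x y assume M: "M = a * x\<^sup>2 + b * y\<^sup>2"
    have "0 \<le> a * x\<^sup>2" "0 \<le> b * y\<^sup>2" using assms by auto
    then have "\<bar>x\<bar> \<le> M" "\<bar>y\<bar> \<le> M"
      using *[of a x] *[of b y] assms M by auto
    then show "x \<in> {- (a * x\<^sup>2 + b * y\<^sup>2)..a * x\<^sup>2 + b * y\<^sup>2}"
      "y \<in> {- (a * x\<^sup>2 + b * y\<^sup>2)..a * x\<^sup>2 + b * y\<^sup>2}"
      unfolding M by auto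
  qed
qed simp

text \<open>Division by \<open>1 + \<surd>-3\<close> in \<open>\<int>[\<surd>-3]\<close>.\<close>

lemma card_eisenstein_form:
  fixes M :: int
  assumes "odd M"
  shows "(of_nat (card {(x::int, y). x mod 4 = 1 \<and> y mod 4 = 1 \<and> x\<^sup>2 + 3 * y\<^sup>2 = 4 * M}) :: bit)
    = of_nat (card {u. u mod 4 = 1 \<and> u\<^sup>2 = M}) + of_nat (card {v. v mod 4 = 1 \<and> 3 * v\<^sup>2 = M})"
proof -
  let ?A = "{(x::int, y). x mod 4 = 1 \<and> y mod 4 = 1 \<and> x\<^sup>2 + 3 * y\<^sup>2 = 4 * M}"
  let ?U = "{(u::int, v). (u + v) mod 4 = 1 \<and> u\<^sup>2 + 3 * v\<^sup>2 = M}"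
  \<comment> \<open>As \<open>u + v\<close> is odd, exactly one coordinate is even, and changing its
    sign alters \<open>u + v\<close> by a multiple of 4. Only solutions with a zero coordinate are
    fixed.\<close>
  let ?g = "\<lambda>(u::int, v). if even v then (u, - v) else (- u, v)"
  let ?P = "{u::int. u mod 4 = 1 \<and> u\<^sup>2 = M}" and ?Q = "{v::int. v mod 4 = 1 \<and> 3 * v\<^sup>2 = M}"
  have "bij_betw (\<lambda>(u, v). (u - 3 * v, u + v)) ?U ?A"
  proof (rule bij_betw_byWitness[where f' = "\<lambda>(x, y). (y - (y - x) div 4, (y - x) div 4)"])
    show "(\<lambda>(u, v). (u - 3 * v, u + v)) ` ?U \<subseteq> ?A"
    proof -
      have "(u - 3 * v) mod 4 = (u + v) mod 4" for u v :: int
        using mod_mult_self2[of "u + v" 4 "- v"] by (simp add: algebra_simps)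
      moreover have "(u - 3 * v)\<^sup>2 + 3 * (u + v)\<^sup>2 = 4 * (u\<^sup>2 + 3 * v\<^sup>2)" for u v :: int
        by (simp add: power2_eq_square algebra_simps)
      ultimately show ?thesis by (simp add: image_subset_iff)
    qed
    have *: "\<exists>v. y = x + 4 * v" if "x mod 4 = 1" "y mod 4 = 1" for x y :: int
      using that by presburger
    show "(\<lambda>(x, y). (y - (y - x) div 4, (y - x) div 4)) ` ?A \<subseteq> ?U"
      using * by (fastforce simp: power2_eq_square algebra_simps)
    show "\<forall>a\<in>?A. (\<lambda>(u, v). (u - 3 * v, u + v)) ((\<lambda>(x, y). (y - (y - x) div 4, (y - x) div 4)) a) = a"
      using * by fastforce
  qed auto
  then have card_A: "card ?A = card ?U" by (simp add: bij_betw_same_card)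
  have invol: "(of_nat (card ?U) :: bit) = of_nat (card {p \<in> ?U. ?g p = p})"
  proof (rule of_nat_card_involution)
    show "finite ?U" by (rule finite_subset[OF _ finite_binary_form[of 1 3 M]]) auto
    fix p assume p: "p \<in> ?U"
    then obtain u v where uv: "p = (u, v)" "(u + v) mod 4 = 1" "u\<^sup>2 + 3 * v\<^sup>2 = M" by auto
    have "(u - v) mod 4 = 1" if "even v" using uv(2) that by presburger
    moreover have "(v - u) mod 4 = 1" if "odd v" using uv(2) that by presburger
    ultimately show "?g p \<in> ?U" using uv by auto
    show "?g (?g p) = p" by (auto split: prod.splits)
  qed
  have fixed: "{p \<in> ?U. ?g p = p} = (\<lambda>u. (u, 0)) ` ?P \<union> (\<lambda>v. (0, v)) ` ?Q"
  proof -
    have "odd v" if "v mod 4 = 1" for v :: int using that by presburger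
    then show ?thesis by (auto simp: image_iff split: if_splits)
  qed
  have "card {p \<in> ?U. ?g p = p} = card ((\<lambda>u. (u, 0 :: int)) ` ?P) + card ((\<lambda>v. (0 :: int, v)) ` ?Q)"
    unfolding fixed
  proof (rule card_Un_disjoint)
    show "finite ((\<lambda>u. (u, 0 :: int)) ` ?P)"
      by (intro finite_imageI finite_subset[OF _ finite_int_square_eq[of M]]) auto
    show "finite ((\<lambda>v. (0 :: int, v)) ` ?Q)"
      by (intro finite_imageI finite_subset[OF _ finite_int_square_eq[of "M div 3"]]) auto
  qed auto
  also have "\<dots> = card ?P + card ?Q"
    by (intro arg_cong2[where f = "(+)"] card_image) (auto simp: inj_on_def)
  finally show ?thesis unfolding card_A invol by simp
qed

section \<open>Solutions of \<open>u^2 + 5 v^2 = M\<close> counted modulo 2\<close>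

lemma three_dvd_square_iff: "3 dvd x\<^sup>2 \<longleftrightarrow> 3 dvd x" for x :: int
  by (rule prime_dvd_power_iff) simp_all

text \<open>Here \<open>y\<close> is prime to 6, so each pair \<open>y, - y\<close> has exactly one
  member that is 1 modulo 4 and exactly one that is 1 modulo 6. This mediates between the two ways
  of normalising the sign.\<close>

lemma card_square_residue_change:
  fixes a M :: int
  assumes "odd M" "\<not> 3 dvd M"
  shows "card {y. y mod 6 = 1 \<and> a * y\<^sup>2 = M} = card {y. y mod 4 = 1 \<and> a * y\<^sup>2 = M}"
proof -
  let ?f = "\<lambda>y::int. if y mod 4 = 1 then y else - y" and ?f' = "\<lambda>y::int. if y mod 6 = 1 then y else - y"
  let ?A = "{y. y mod 6 = 1 \<and> a * y\<^sup>2 = M}" and ?B = "{y. y mod 4 = 1 \<and> a * y\<^sup>2 = M}"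
  have *: "odd y" "\<not> 3 dvd y" if "a * y\<^sup>2 = M" for y
    using that assms by (auto simp: power2_eq_square)
  have 4: "(- y) mod 4 = 1" if "odd y" "y mod 4 \<noteq> 1" for y :: int using that by presburger
  have 6: "(- y) mod 6 = 1" if "odd y" "\<not> 3 dvd y" "y mod 6 \<noteq> 1" for y :: int using that by presburger
  have n4: "(- y) mod 4 \<noteq> 1" if "y mod 4 = 1" for y :: int using that by presburger
  have n6: "(- y) mod 6 \<noteq> 1" if "y mod 6 = 1" for y :: int using that by presburger
  have "bij_betw ?f ?A ?B"
  proof (rule bij_betw_byWitness[where f' = ?f'])
    show "\<forall>y\<in>?A. ?f' (?f y) = y" by (auto dest: n6)
    show "\<forall>y\<in>?B. ?f (?f' y) = y" by (auto dest: n4)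
    show "?f ` ?A \<subseteq> ?B" using * 4 by auto
    show "?f' ` ?B \<subseteq> ?A" using * 6 by auto
  qed
  then show ?thesis by (simp add: bij_betw_same_card)
qed

text \<open>A solution on the left is a multiple of 3. The bijection multiplies by -3, which is 1
  modulo 4 and so keeps the residue.\<close>

lemma card_square_scale_9:
  fixes a M :: int
  assumes "\<not> 3 dvd a"
  shows "card {y. y mod 4 = 1 \<and> a * y\<^sup>2 = 9 * M} = card {y. y mod 4 = 1 \<and> a * y\<^sup>2 = M}"
proof -
  have "bij_betw (\<lambda>y. - (3 * y)) {y. y mod 4 = 1 \<and> a * y\<^sup>2 = M} {y. y mod 4 = 1 \<and> a * y\<^sup>2 = 9 * M}"
  proof (rule bij_betw_byWitness[where f' = "\<lambda>y. - (y div 3)"])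
    show "(\<lambda>y. - (3 * y)) ` {y. y mod 4 = 1 \<and> a * y\<^sup>2 = M} \<subseteq> {y. y mod 4 = 1 \<and> a * y\<^sup>2 = 9 * M}"
      by (auto simp: power2_eq_square) presburger
    have *: "3 dvd y" if "a * y\<^sup>2 = 9 * M" for y
    proof -
      have "3 dvd a * y\<^sup>2" using that by simp
      then show ?thesis using assms by (auto simp: prime_dvd_mult_iff three_dvd_square_iff)
    qed
    show "\<forall>y\<in>{y. y mod 4 = 1 \<and> a * y\<^sup>2 = 9 * M}. - (3 * (- (y div 3))) = y"
      using * by auto
    show "(\<lambda>y. - (y div 3)) ` {y. y mod 4 = 1 \<and> a * y\<^sup>2 = 9 * M} \<subseteq> {y. y mod 4 = 1 \<and> a * y\<^sup>2 = M}"
    proof clarify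
      fix y assume y: "y mod 4 = 1" "a * y\<^sup>2 = 9 * M"
      obtain z where z: "y = 3 * z" using *[OF y(2)] by blast
      have "(- z) mod 4 = 1" using y(1) z by presburger
      then show "(- (y div 3)) mod 4 = 1 \<and> a * (- (y div 3))\<^sup>2 = M"
        using y z by (simp add: power2_eq_square)
    qed
  qed auto
  then show ?thesis by (simp add: bij_betw_same_card)
qed

text \<open>Modulo 3 the form is \<open>u^2 - v^2\<close>, and \<open>u + v\<close> is 1, so exactly
  one of \<open>u\<close>, \<open>v\<close> is a multiple of 3. Changing its sign keeps
  \<open>u + v\<close> modulo 6 and fixes only solutions with a zero coordinate.\<close>

lemma card_disc20_form_coprime:
  fixes M :: int
  assumes M: "M mod 4 = 1" "\<not> 3 dvd M"
  shows "(of_nat (card {(u::int, v). (u + v) mod 6 = 1 \<and> u\<^sup>2 + 5 * v\<^sup>2 = M}) :: bit)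
    = of_nat (card {y. y mod 4 = 1 \<and> y\<^sup>2 = M}) + of_nat (card {y. y mod 4 = 1 \<and> 5 * y\<^sup>2 = M})"
proof -
  let ?U = "{(u::int, v). (u + v) mod 6 = 1 \<and> u\<^sup>2 + 5 * v\<^sup>2 = M}"
  let ?g = "\<lambda>(u::int, v). if 3 dvd v then (u, - v) else (- u, v)"
  let ?P = "{u::int. u mod 6 = 1 \<and> 1 * u\<^sup>2 = M}" and ?Q = "{v::int. v mod 6 = 1 \<and> 5 * v\<^sup>2 = M}"
  have u3: "3 dvd u" if "(u + v) mod 6 = 1" "u\<^sup>2 + 5 * v\<^sup>2 = M" "\<not> 3 dvd v" for u v :: int
  proof (rule ccontr)
    assume "\<not> 3 dvd u"
    with that have "\<exists>a b. u = 3 * a + 2 \<and> v = 3 * b + 2" by presburger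
    then obtain a b where "u = 3 * a + 2" "v = 3 * b + 2" by blast
    then have "M = 3 * (3 * a\<^sup>2 + 4 * a + 15 * b\<^sup>2 + 20 * b + 8)"
      using that(2) by (simp add: power2_eq_square algebra_simps)
    then show False using M(2) by simp
  qed
  have invol: "(of_nat (card ?U) :: bit) = of_nat (card {p \<in> ?U. ?g p = p})"
  proof (rule of_nat_card_involution)
    show "finite ?U" by (rule finite_subset[OF _ finite_binary_form[of 1 5 M]]) auto
    fix p assume p: "p \<in> ?U"
    then obtain u v where uv: "p = (u, v)" "(u + v) mod 6 = 1" "u\<^sup>2 + 5 * v\<^sup>2 = M" by auto
    have "(u - v) mod 6 = 1" if "3 dvd v" using uv(2) that by presburger
    moreover have "(v - u) mod 6 = 1" if "3 dvd u" using uv(2) that by presburger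
    ultimately show "?g p \<in> ?U" using uv u3[OF uv(2,3)] by auto
    show "?g (?g p) = p" by (auto split: prod.splits)
  qed
  have fixed: "{p \<in> ?U. ?g p = p} = (\<lambda>u. (u, 0)) ` ?P \<union> (\<lambda>v. (0, v)) ` ?Q"
  proof -
    have "\<not> 3 dvd v" if "v mod 6 = 1" for v :: int using that by presburger
    then show ?thesis by (auto simp: image_iff split: if_splits)
  qed
  have "card {p \<in> ?U. ?g p = p} = card ((\<lambda>u. (u, 0 :: int)) ` ?P) + card ((\<lambda>v. (0 :: int, v)) ` ?Q)"
    unfolding fixed
  proof (rule card_Un_disjoint)
    show "finite ((\<lambda>u. (u, 0 :: int)) ` ?P)"
      by (intro finite_imageI finite_subset[OF _ finite_int_square_eq[of M]]) auto
    show "finite ((\<lambda>v. (0 :: int, v)) ` ?Q)"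
      by (intro finite_imageI finite_subset[OF _ finite_int_square_eq[of "M div 5"]]) auto
  qed auto
  also have "\<dots> = card ?P + card ?Q"
    by (intro arg_cong2[where f = "(+)"] card_image) (auto simp: inj_on_def)
  also have "\<dots> = card {y. y mod 4 = 1 \<and> 1 * y\<^sup>2 = M} + card {y. y mod 4 = 1 \<and> 5 * y\<^sup>2 = M}"
  proof -
    have "odd M" using M(1) by presburger
    then show ?thesis by (intro arg_cong2[where f = "(+)"] card_square_residue_change M(2))
  qed
  finally show ?thesis unfolding invol by simp
qed

text \<open>
  If \<open>3\<close> divides \<open>M\<close>, every solution is \<open>(s - 2 w, s + w)\<close>, where \<open>2 s\<^sup>2 + 2 s w + 3 w\<^sup>2 = M / 3\<close>.
  An automorphism of this form, chosen according to \<open>s mod 3\<close>, pairs off the solutions with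
  \<open>s\<close> prime to \<open>3\<close>; the others are multiples of \<open>2 - \<surd>-5\<close> and come from \<open>M / 9\<close>.
\<close>

lemma card_disc20_form_descent:
  fixes M :: int
  assumes M: "3 dvd M"
  shows "(of_nat (card {(u::int, v). (u + v) mod 6 = 1 \<and> u\<^sup>2 + 5 * v\<^sup>2 = M}) :: bit)
    = (if 9 dvd M then of_nat (card {(u::int, v). (u + v) mod 6 = 1 \<and> u\<^sup>2 + 5 * v\<^sup>2 = M div 9}) else 0)"
proof -
  let ?U = "\<lambda>M. {(u::int, v). (u + v) mod 6 = 1 \<and> u\<^sup>2 + 5 * v\<^sup>2 = M}"
  \<comment> \<open>In terms of \<open>s = (u + 2 v) / 3\<close>, the set \<open>D\<close> consists
    of the solutions with \<open>s\<close> divisible by 3.\<close>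
  define D where "D = {(u, v). (u, v) \<in> ?U M \<and> 9 dvd u + 2 * v}"
  \<comment> \<open>In the coordinates \<open>(s, w)\<close> the two branches are
    \<open>(s + w, - w)\<close> and \<open>(- s - w, w)\<close>. They keep
    \<open>u + v = 2 s - w\<close> modulo 6 when 3 divides \<open>w\<close>, respectively
    \<open>2 s + w\<close>.\<close>
  define g where "g = (\<lambda>(u::int, v). let s = (u + 2 * v) div 3; w = (v - u) div 3 in
      if s mod 3 = 2 then (s + 3 * w, s) else (- (s + 3 * w), - s))"
  have g: "g (s - 2 * w, s + w) = (if s mod 3 = 2 then (s + 3 * w, s) else (- (s + 3 * w), - s))" for s w
  proof -
    have "s - 2 * w + 2 * (s + w) = 3 * s" "s + w - (s - 2 * w) = 3 * w" by simp_all
    then show ?thesis unfolding g_def prod.case by (simp only: Let_def) simp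
  qed
  have sw: "\<exists>s w. u = s - 2 * w \<and> v = s + w \<and> (s + w) mod 3 = 2 \<and> odd w"
    if "(u + v) mod 6 = 1" "u\<^sup>2 + 5 * v\<^sup>2 = M" for u v
  proof -
    have "3 dvd (u + v) * (u - v)"
    proof -
      have "(u + v) * (u - v) = M - 3 * (2 * v\<^sup>2)"
        using that(2) by (simp add: power2_eq_square algebra_simps)
      then show ?thesis using M by simp
    qed
    moreover have "\<not> 3 dvd u + v" using that(1) by presburger
    ultimately have "3 dvd u - v" by (simp add: prime_dvd_mult_iff)
    then obtain w where w: "u = v - 3 * w" by (metis add_diff_cancel_left' diff_diff_eq2 dvdE minus_diff_eq mult_minus_right)
    have "v mod 3 = 2" "odd w" using that(1) w by presburger+
    then show ?thesis using w by (intro exI[of _ "v - w"] exI[of _ w]) simp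
  qed
  \<comment> \<open>A fixed point would satisfy \<open>w = 0\<close> in the first case and
    \<open>w = - 2 s\<close> in the second, but \<open>w\<close> is odd.\<close>
  have g_in: "g p \<in> ?U M - D \<and> g (g p) = p \<and> g p \<noteq> p" if p: "p \<in> ?U M - D" for p
  proof -
    obtain u v where uv: "p = (u, v)" "(u + v) mod 6 = 1" "u\<^sup>2 + 5 * v\<^sup>2 = M" using p by auto
    from sw[OF uv(2,3)] obtain s w where s: "u = s - 2 * w" "v = s + w" "(s + w) mod 3 = 2" "odd w" by blast
    have m6: "(2 * s - w) mod 6 = 1" using uv(2) s by (simp add: algebra_simps)
    have n9: "\<not> 9 dvd 3 * s" using p uv s by (auto simp: D_def algebra_simps)
    have "s mod 3 = 2 \<and> w mod 3 = 0 \<or> s mod 3 = 1 \<and> w mod 3 = 1"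
      using n9 s(3) by presburger
    then consider "s mod 3 = 2" "w mod 3 = 0" | "s mod 3 = 1" "w mod 3 = 1" by blast
    then show ?thesis
    proof cases
      case 1
      have e: "g p = (s + 3 * w, s)" using 1 s uv(1) g by simp
      have e2: "(s + 3 * w, s) = ((s + w) - 2 * (- w), (s + w) + (- w))" by simp
      have "g (g p) = p" unfolding e e2 g using s uv(1) by simp
      moreover have "g p \<noteq> p" using e s uv(1) by auto
      moreover have "(s + 3 * w)\<^sup>2 + 5 * s\<^sup>2 = M"
        using uv(3) unfolding s by (simp add: power2_eq_square algebra_simps)
      moreover have "(s + 3 * w + s) mod 6 = 1"
      proof -
        from 1(2) obtain k where "w = 3 * k" by blast
        then have "s + 3 * w + s = 2 * s - w + 6 * (2 * k)" by simp
        then show ?thesis using m6 by (metis mod_mult_self2)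
      qed
      moreover have "\<not> 9 dvd s + 3 * w + 2 * s" using 1 by presburger
      ultimately show ?thesis by (simp add: e D_def)
    next
      case 2
      have e: "g p = (- (s + 3 * w), - s)" using 2 s uv(1) g by simp
      have e2: "(- (s + 3 * w), - s) = ((- s - w) - 2 * w, (- s - w) + w)" by simp
      have m: "(- s - w) mod 3 = 1" using 2 by presburger
      have "g (g p) = p" unfolding e e2 g using s uv(1) m by simp
      moreover have "w + 2 * s \<noteq> 0" using s(4) by presburger
      then have "g p \<noteq> p" using e s uv(1) by auto
      moreover have "(- (s + 3 * w))\<^sup>2 + 5 * (- s)\<^sup>2 = M"
        using uv(3) unfolding s by (simp add: power2_eq_square algebra_simps)
      moreover have "(- (s + 3 * w) + - s) mod 6 = 1"
      proof -
        have "\<exists>j k. s = 3 * j + 1 \<and> w = 3 * k + 1" using 2 by presburger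
        then obtain j k where "s = 3 * j + 1" "w = 3 * k + 1" by blast
        then have "- (s + 3 * w) + - s = 2 * s - w + 6 * (- 2 * j - k - 1)" by simp
        then show ?thesis using m6 by (metis mod_mult_self2)
      qed
      moreover have "\<not> 9 dvd - (s + 3 * w) + 2 * - s" using 2 by presburger
      ultimately show ?thesis by (simp add: e D_def)
    qed
  qed
  have fin: "finite (?U M)" for M by (rule finite_subset[OF _ finite_binary_form[of 1 5 M]]) auto
  have card_U: "(of_nat (card (?U M)) :: bit) = of_nat (card D)"
    by (rule of_nat_card_involution_off[OF fin _ g_in]) (auto simp: D_def)
  have D9: "9 dvd M" if uv: "(u, v) \<in> D" for u v
  proof -
    from uv have "(u + v) mod 6 = 1" "u\<^sup>2 + 5 * v\<^sup>2 = M" "9 dvd u + 2 * v" by (auto simp: D_def)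
    moreover from this sw obtain s w where s: "u = s - 2 * w" "v = s + w" by blast
    ultimately have "9 dvd 3 * s" by (simp add: algebra_simps)
    then obtain V where V: "s = 3 * V" by (auto elim!: dvdE)
    have "M = 9 * (6 * V\<^sup>2 + 2 * V * w + w\<^sup>2)"
      using \<open>u\<^sup>2 + 5 * v\<^sup>2 = M\<close> s V by (simp add: power2_eq_square algebra_simps)
    then show ?thesis by simp
  qed
  show ?thesis
  proof (cases "9 dvd M")
    case False
    then have "D = {}" using D9 by auto
    then show ?thesis using False card_U by simp
  next
    case True
    then obtain K where K: "M = 9 * K" by blast
    \<comment> \<open>Multiplication of \<open>u + v \<surd>-5\<close> by
      \<open>2 - \<surd>-5\<close>, which has norm 9.\<close>
    have "bij_betw (\<lambda>(u, v). (2 * u + 5 * v, 2 * v - u)) (?U K) D"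
    proof (rule bij_betw_byWitness[where f' = "\<lambda>(u, v). ((2 * u - 5 * v) div 9, (u + 2 * v) div 9)"])
      show "\<forall>a\<in>?U K. (\<lambda>(u, v). ((2 * u - 5 * v) div 9, (u + 2 * v) div 9))
          ((\<lambda>(u, v). (2 * u + 5 * v, 2 * v - u)) a) = a" by auto
      have *: "\<exists>U V. u = 2 * U + 5 * V \<and> v = 2 * V - U" if uv: "9 dvd u + 2 * v" for u v :: int
      proof -
        obtain V where "u + 2 * v = 9 * V" using uv by blast
        then show ?thesis by (intro exI[of _ "2 * V - v"] exI[of _ V]) simp
      qed
      show "\<forall>a\<in>D. (\<lambda>(u, v). (2 * u + 5 * v, 2 * v - u))
          ((\<lambda>(u, v). ((2 * u - 5 * v) div 9, (u + 2 * v) div 9)) a) = a"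
        using * by (fastforce simp: D_def)
      have eq: "(2 * u + 5 * v)\<^sup>2 + 5 * (2 * v - u)\<^sup>2 = 9 * (u\<^sup>2 + 5 * v\<^sup>2)" for u v :: int
        by (simp add: power2_eq_square algebra_simps)
      have md: "(2 * u + 5 * v + (2 * v - u)) mod 6 = (u + v) mod 6" for u v :: int
        using mod_mult_self2[of "u + v" 6 v] by (simp add: algebra_simps)
      have dv: "9 dvd 2 * u + 5 * v + 2 * (2 * v - u)" for u v :: int by simp
      show "(\<lambda>(u, v). (2 * u + 5 * v, 2 * v - u)) ` ?U K \<subseteq> D"
        unfolding D_def using K by (auto simp only: eq md dv)
      show "(\<lambda>(u, v). ((2 * u - 5 * v) div 9, (u + 2 * v) div 9)) ` D \<subseteq> ?U K"
      proof clarify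
        fix u v assume uv: "(u, v) \<in> D"
        have "9 dvd u + 2 * v" using uv by (simp add: D_def)
        from *[OF this] obtain U V where UV: "u = 2 * U + 5 * V" "v = 2 * V - U" by blast
        have "(2 * u - 5 * v) div 9 = U" "(u + 2 * v) div 9 = V" unfolding UV by simp_all
        moreover have "(U + V) mod 6 = 1" "U\<^sup>2 + 5 * V\<^sup>2 = K"
          using uv K eq[of U V] md[of U V] by (simp_all add: D_def flip: UV)
        ultimately show "((2 * u - 5 * v) div 9 + (u + 2 * v) div 9) mod 6 = 1 \<and>
            ((2 * u - 5 * v) div 9)\<^sup>2 + 5 * ((u + 2 * v) div 9)\<^sup>2 = K" by simp
      qed
    qed
    then have "card D = card (?U K)" by (simp add: bij_betw_same_card)
    then show ?thesis using card_U K by simp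
  qed
qed

text \<open>Factors 9 are removed by descent until 3 does not divide \<open>M\<close>, or divides it
  exactly once. In the latter case the left side is even and no multiple-of-square equation on the
  right is solvable.\<close>

lemma card_disc20_form:
  fixes M :: int
  assumes "M > 0" "M mod 4 = 1"
  shows "(of_nat (card {(u::int, v). (u + v) mod 6 = 1 \<and> u\<^sup>2 + 5 * v\<^sup>2 = M}) :: bit)
    = of_nat (card {y. y mod 4 = 1 \<and> y\<^sup>2 = M}) + of_nat (card {y. y mod 4 = 1 \<and> 5 * y\<^sup>2 = M})"
  using assms
proof (induction "nat M" arbitrary: M rule: less_induct)
  case less
  consider "\<not> 3 dvd M" | "3 dvd M" "\<not> 9 dvd M" | K where "M = 9 * K" by blast
  then show ?case
  proof cases
    case 1
    then show ?thesis using card_disc20_form_coprime less.prems by blast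
  next
    case 2
    have "9 dvd M" if y: "a * y\<^sup>2 = M" "\<not> 3 dvd a" for a y
    proof -
      have "3 dvd y" using 2(1) y by (auto simp: prime_dvd_mult_iff three_dvd_square_iff)
      then obtain z where "y = 3 * z" by blast
      then have "M = 9 * (a * z\<^sup>2)" using y(1) by (simp add: power2_eq_square)
      then show ?thesis by simp
    qed
    from this[of 1] this[of 5] 2(2)
    have *: "{y. y mod 4 = 1 \<and> y\<^sup>2 = M} = {}" "{y. y mod 4 = 1 \<and> 5 * y\<^sup>2 = M} = {}" by auto
    show ?thesis unfolding * card_disc20_form_descent[OF 2(1)] using 2(2) by simp
  next
    case 3
    have "K > 0" "K mod 4 = 1" using less.prems 3 by presburger+
    then show ?thesis
      using less.hyps[of K] card_disc20_form_descent[of M] card_square_scale_9[of 1 K] card_square_scale_9[of 5 K] 3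
      by simp
  qed
qed

text \<open>The change of variables \<open>Y = (x + 9 y) / 2\<close>, \<open>X = 16 y - 3 Y\<close> satisfies
  \<open>3 X\<^sup>2 + 5 Y\<^sup>2 = 8 (x\<^sup>2 + 15 y\<^sup>2)\<close>.\<close>

lemma card_disc60_form_halving:
  fixes n :: int
  shows "(of_nat (card {(X::int, Y). X mod 4 = 1 \<and> \<not> 3 dvd X \<and> Y mod 4 = 1 \<and> \<not> 3 dvd Y \<and>
      3 * X\<^sup>2 + 5 * Y\<^sup>2 = 96 * n + 32}) :: bit) =
    of_nat (card {(x::int, y). x mod 4 = 1 \<and> \<not> 3 dvd x \<and> y mod 4 = 1 \<and> \<not> 3 dvd y \<and>
      x\<^sup>2 + 15 * y\<^sup>2 = 12 * n + 4})"
proof -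
  let ?A = "{(X::int, Y). X mod 4 = 1 \<and> \<not> 3 dvd X \<and> Y mod 4 = 1 \<and> \<not> 3 dvd Y \<and> 3 * X\<^sup>2 + 5 * Y\<^sup>2 = 96 * n + 32}"
  let ?C = "{(x::int, y). x mod 4 = 1 \<and> \<not> 3 dvd x \<and> y mod 4 = 1 \<and> \<not> 3 dvd y \<and> x\<^sup>2 + 15 * y\<^sup>2 = 12 * n + 4}"
  \<comment> \<open>Pulled back to \<open>(x, y)\<close>, the condition \<open>Y mod 4 = 1\<close>
    becomes \<open>(x + 9 * y) mod 8 = 2\<close>, and 3 divides \<open>X = 16 y - 3 Y\<close>
    exactly when it divides \<open>y\<close>.\<close>
  define B where "B = {(x::int, y). (x + 9 * y) mod 8 = 2 \<and> \<not> 3 dvd y \<and> x\<^sup>2 + 15 * y\<^sup>2 = 12 * n + 4}"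
  have x3: "\<not> 3 dvd x" if "x\<^sup>2 + 15 * y\<^sup>2 = 12 * n + 4" for x y
  proof -
    have "x\<^sup>2 = 3 * (4 * n + 1 - 5 * y\<^sup>2) + 1" using that by simp
    then have "\<not> 3 dvd x\<^sup>2" by presburger
    then show ?thesis by (simp add: three_dvd_square_iff)
  qed
  have "bij_betw (\<lambda>(x, y). (16 * y - 3 * ((x + 9 * y) div 2), (x + 9 * y) div 2)) B ?A"
  proof (rule bij_betw_byWitness[where f' = "\<lambda>(X, Y). (2 * Y - 9 * ((X + 3 * Y) div 16), (X + 3 * Y) div 16)"])
    show "\<forall>a\<in>B. (\<lambda>(X, Y). (2 * Y - 9 * ((X + 3 * Y) div 16), (X + 3 * Y) div 16))
        ((\<lambda>(x, y). (16 * y - 3 * ((x + 9 * y) div 2), (x + 9 * y) div 2)) a) = a"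
    proof -
      have "\<exists>k. x + 9 * y = 2 * k" if "(x + 9 * y) mod 8 = 2" for x y :: int using that by presburger
      then show ?thesis by (fastforce simp: B_def)
    qed
    \<comment> \<open>The equation makes 32 divide \<open>3 (X - 3 Y) (X + 3 Y)\<close>. As
      \<open>X - 3 Y\<close> is twice an odd number, 16 divides \<open>X + 3 Y\<close>.\<close>
    have *: "\<exists>x y. X = 16 * y - 3 * Y \<and> x = 2 * Y - 9 * y \<and> (x + 9 * y) div 2 = Y"
      if XY: "X mod 4 = 1" "Y mod 4 = 1" "3 * X\<^sup>2 + 5 * Y\<^sup>2 = 96 * n + 32" for X Y
    proof -
      have "\<exists>c. X - 3 * Y = 2 * c \<and> odd c" using XY(1,2) by presburger
      then obtain c where c: "X - 3 * Y = 2 * c" "odd c" by blast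
      have "3 * ((X - 3 * Y) * (X + 3 * Y)) = 96 * n + 32 - 32 * Y\<^sup>2"
        using XY(3) by (simp add: power2_eq_square algebra_simps)
      then have "3 * (c * (X + 3 * Y)) = 16 * (3 * n + 1 - Y\<^sup>2)" unfolding c(1) by simp
      then have "16 dvd (3 * c) * (X + 3 * Y)" by (simp add: mult.assoc)
      moreover have "coprime 16 (3 * c)"
        using c(2) coprime_power_left_iff[of 2 4 "3 * c"] by simp
      ultimately have "16 dvd X + 3 * Y" by (simp add: coprime_dvd_mult_right_iff)
      then obtain y where "X + 3 * Y = 16 * y" by blast
      then show ?thesis by (intro exI[of _ "2 * Y - 9 * y"] exI[of _ y]) auto
    qed
    show "\<forall>a\<in>?A. (\<lambda>(x, y). (16 * y - 3 * ((x + 9 * y) div 2), (x + 9 * y) div 2))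
        ((\<lambda>(X, Y). (2 * Y - 9 * ((X + 3 * Y) div 16), (X + 3 * Y) div 16)) a) = a"
      using * by fastforce
    show "(\<lambda>(x, y). (16 * y - 3 * ((x + 9 * y) div 2), (x + 9 * y) div 2)) ` B \<subseteq> ?A"
    proof clarify
      fix x y assume "(x, y) \<in> B"
      then have xy: "(x + 9 * y) mod 8 = 2" "\<not> 3 dvd y" "x\<^sup>2 + 15 * y\<^sup>2 = 12 * n + 4"
        by (auto simp: B_def)
      have "\<exists>k. x + 9 * y = 8 * k + 2" using xy(1) by presburger
      then obtain k where k: "x + 9 * y = 8 * k + 2" by blast
      define Y where "Y = 4 * k + 1"
      have Y: "(x + 9 * y) div 2 = Y" "x = 2 * Y - 9 * y" "Y mod 4 = 1" using k by (auto simp: Y_def)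
      have "3 * (16 * y - 3 * Y)\<^sup>2 + 5 * Y\<^sup>2 = 8 * (x\<^sup>2 + 15 * y\<^sup>2)"
        unfolding Y(2) by (simp add: power2_eq_square algebra_simps)
      moreover have "\<not> 3 dvd Y" using x3[OF xy(3)] Y(2) by presburger
      moreover have "\<not> 3 dvd 16 * y - 3 * Y" using xy(2) by presburger
      moreover have "(16 * y - 3 * Y) mod 4 = 1" using Y(3) by presburger
      ultimately show "(16 * y - 3 * ((x + 9 * y) div 2)) mod 4 = 1 \<and>
          \<not> 3 dvd 16 * y - 3 * ((x + 9 * y) div 2) \<and> (x + 9 * y) div 2 mod 4 = 1 \<and>
          \<not> 3 dvd (x + 9 * y) div 2 \<and>
          3 * (16 * y - 3 * ((x + 9 * y) div 2))\<^sup>2 + 5 * ((x + 9 * y) div 2)\<^sup>2 = 96 * n + 32"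
        using Y xy(3) by simp
    qed
    show "(\<lambda>(X, Y). (2 * Y - 9 * ((X + 3 * Y) div 16), (X + 3 * Y) div 16)) ` ?A \<subseteq> B"
    proof clarify
      fix X Y assume XY: "X mod 4 = 1" "\<not> 3 dvd X" "Y mod 4 = 1" "\<not> 3 dvd Y" "3 * X\<^sup>2 + 5 * Y\<^sup>2 = 96 * n + 32"
      obtain y where y: "X = 16 * y - 3 * Y" using *[OF XY(1,3,5)] by blast
      have "(X + 3 * Y) div 16 = y" using y by simp
      moreover have "(2 * Y - 9 * y + 9 * y) mod 8 = 2" using XY(3) by presburger
      moreover have "\<not> 3 dvd y" using XY(2) y by presburger
      moreover have "8 * ((2 * Y - 9 * y)\<^sup>2 + 15 * y\<^sup>2) = 3 * X\<^sup>2 + 5 * Y\<^sup>2"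
        unfolding y by (simp add: power2_eq_square algebra_simps)
      ultimately show "(2 * Y - 9 * ((X + 3 * Y) div 16), (X + 3 * Y) div 16) \<in> B"
        using XY(5) by (simp add: B_def)
    qed
  qed
  then have card_A: "card ?A = card B" by (simp add: bij_betw_same_card)
  define E where "E = {(x, y). (x, y) \<in> B \<and> odd y}"
  \<comment> \<open>Solutions with even \<open>y\<close> cancel: if 4 does not divide
    \<open>y\<close>, then it divides \<open>x\<close>, so the sign change alters
    \<open>x + 9 y\<close> by a multiple of 8. Neither coordinate is 0, since 3 divides
    neither.\<close>
  define g where "g = (\<lambda>(x::int, y::int). if 4 dvd y then (x, - y) else (- x, y))"
  have "finite B"
    by (rule finite_subset[OF _ finite_binary_form[of 1 15 "12 * n + 4"]]) (auto simp: B_def)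
  moreover have "E \<subseteq> B" by (auto simp: E_def)
  moreover have "g p \<in> B - E \<and> g (g p) = p \<and> g p \<noteq> p" if p: "p \<in> B - E" for p
  proof -
    obtain x y where xy: "p = (x, y)" "(x + 9 * y) mod 8 = 2" "\<not> 3 dvd y" "x\<^sup>2 + 15 * y\<^sup>2 = 12 * n + 4" "even y"
      using p by (cases p) (auto simp: E_def B_def)
    have "x \<noteq> 0" "y \<noteq> 0" using x3[OF xy(4)] xy(3) by auto
    moreover have "(x + 9 * (- y)) mod 8 = 2" if y4: "4 dvd y"
    proof -
      obtain j where "y = 4 * j" using y4 by blast
      then have "x + 9 * (- y) = x + 9 * y + 8 * (- 9 * j)" by simp
      then show ?thesis using xy(2) by (metis mod_mult_self2)
    qed
    moreover have "(- x + 9 * y) mod 8 = 2" if "\<not> 4 dvd y"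
    proof -
      have "\<exists>j. y = 4 * j + 2" using xy(5) that by presburger
      then obtain j where j: "y = 4 * j + 2" by blast
      define k where "k = (x + 9 * y) div 8"
      have "x + 9 * y = 8 * k + 2" using mult_div_mod_eq[of 8 "x + 9 * y"] xy(2) by (simp add: k_def)
      then have "- x + 9 * y = 2 + 8 * (9 * j + 4 - k)" using j by simp
      then show ?thesis by (simp only: mod_mult_self2) simp
    qed
    ultimately show ?thesis using xy by (auto simp: g_def E_def B_def)
  qed
  ultimately have card_B: "(of_nat (card B) :: bit) = of_nat (card E)"
    by (rule of_nat_card_involution_off)
  have key: "x mod 4 = 1 \<and> y mod 4 = 1 \<or>
      x mod 4 \<noteq> 1 \<and> (- x) mod 4 = 1 \<and> (- y) mod 4 = 1 \<and> (- x + 9 * (- y)) mod 8 \<noteq> 2"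
    if xy: "(x + 9 * y) mod 8 = 2" "odd y" for x y :: int
  proof -
    define k where "k = (x + 9 * y) div 8"
    have k: "x + 9 * y = 8 * k + 2" using mult_div_mod_eq[of 8 "x + 9 * y"] xy(1) by (simp add: k_def)
    have "\<exists>j. y = 4 * j + 1 \<or> y = 4 * j + 3" using xy(2) by presburger
    then obtain j where "y = 4 * j + 1 \<or> y = 4 * j + 3" by blast
    then show ?thesis
    proof
      assume y: "y = 4 * j + 1"
      define m where "m = 2 * k - 9 * j - 2"
      have x: "x = 4 * m + 1" using k y by (simp add: m_def)
      show ?thesis unfolding x y by simp
    next
      assume y: "y = 4 * j + 3"
      define m where "m = 2 * k - 9 * j - 7"
      have x: "x = 4 * m + 3" using k y by (simp add: m_def)
      have "- x + 9 * (- y) = 8 * (- k - 1) + 6" using k by simp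
      moreover have "- x = 4 * (- m - 1) + 1" "- y = 4 * (- j - 1) + 1" using x y by simp_all
      ultimately show ?thesis
        by (simp only: x mod_mult_self4) simp
    qed
  qed
  have 3: "odd y" if "y mod 4 = 1" for y :: int using that by presburger
  have 4: "(- x + 9 * (- y)) mod 8 = 2 \<and> (- x) mod 4 \<noteq> 1"
    if xy: "(x + 9 * y) mod 8 \<noteq> 2" "x mod 4 = 1" "y mod 4 = 1" for x y :: int
  proof -
    obtain a b where ab: "x = 4 * a + 1" "y = 4 * b + 1"
      using xy(2,3) by (metis mult_div_mod_eq)
    have "odd (a + 9 * b)"
    proof
      assume "even (a + 9 * b)"
      then obtain c where "a + 9 * b = 2 * c" by blast
      then have "x + 9 * y = 8 * (c + 1) + 2" using ab by simp
      then show False using xy(1) by (simp only: mod_mult_self4) simp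
    qed
    then obtain c where "a + 9 * b = 2 * c + 1" by (elim oddE)
    then have "- x + 9 * (- y) = 8 * (- c - 2) + 2" "- x = 4 * (- a - 1) + 3" using ab by simp_all
    then show ?thesis by (simp only: mod_mult_self4) simp
  qed
  \<comment> \<open>For odd \<open>y\<close>, both \<open>B\<close> and the target set select one of
    \<open>(x, y)\<close> and \<open>(- x, - y)\<close>; \<open>h\<close> and \<open>h'\<close>
    translate between the two selections.\<close>
  define h where "h = (\<lambda>(x::int, y::int). if x mod 4 = 1 then (x, y) else (- x, - y))"
  define h' where "h' = (\<lambda>(x::int, y::int). if (x + 9 * y) mod 8 = 2 then (x, y) else (- x, - y))"
  have E_C: "h p \<in> ?C \<and> h' (h p) = p" if p: "p \<in> E" for p
  proof -
    obtain x y where xy: "p = (x, y)" "(x + 9 * y) mod 8 = 2" "\<not> 3 dvd y" "x\<^sup>2 + 15 * y\<^sup>2 = 12 * n + 4" "odd y"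
      using p by (cases p) (auto simp: E_def B_def)
    from key[OF xy(2,5)] show ?thesis
    proof (elim disjE conjE)
      assume "x mod 4 = 1" "y mod 4 = 1"
      then show ?thesis using xy(2-4) x3[OF xy(4)] unfolding xy(1) h_def h'_def by simp
    next
      assume *: "x mod 4 \<noteq> 1" "(- x) mod 4 = 1" "(- y) mod 4 = 1" "(- x + 9 * (- y)) mod 8 \<noteq> 2"
      have "h p = (- x, - y)" using *(1) by (simp add: xy(1) h_def)
      moreover have "h' (- x, - y) = (x, y)"
        unfolding h'_def prod.case if_not_P[OF *(4)] by simp
      ultimately show ?thesis using *(2,3) xy(1,3,4) x3[OF xy(4)] by simp
    qed
  qed
  have C_E: "h' p \<in> E \<and> h (h' p) = p" if p: "p \<in> ?C" for p
  proof -
    obtain x y where xy: "p = (x, y)" "x mod 4 = 1" "y mod 4 = 1" "\<not> 3 dvd y" "x\<^sup>2 + 15 * y\<^sup>2 = 12 * n + 4"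
      using p by (cases p) auto
    show ?thesis
    proof (cases "(x + 9 * y) mod 8 = 2")
      case True
      then show ?thesis using xy(2-5) 3[OF xy(3)] unfolding xy(1) h_def h'_def E_def B_def by simp
    next
      case False
      note * = 4[OF False xy(2,3)]
      have "h' p = (- x, - y)" using False by (simp add: xy(1) h'_def)
      moreover have "h (- x, - y) = (x, y)" using * by (simp add: h_def)
      moreover have "(- x, - y) \<in> E"
        unfolding E_def B_def mem_Collect_eq prod.case using * xy(4,5) 3[OF xy(3)] by simp
      ultimately show ?thesis by (simp add: xy(1))
    qed
  qed
  have "bij_betw h E ?C"
  proof (rule bij_betw_byWitness[where f' = h'])
    show "\<forall>a\<in>E. h' (h a) = a" by (intro ballI conjunct2[OF E_C])
    show "\<forall>a\<in>?C. h (h' a) = a" by (intro ballI conjunct2[OF C_E])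
    show "h ` E \<subseteq> ?C" by (intro image_subsetI conjunct1[OF E_C])
    show "h' ` ?C \<subseteq> E" by (intro image_subsetI conjunct1[OF C_E])
  qed
  then have "card E = card ?C" by (simp add: bij_betw_same_card)
  then show ?thesis unfolding card_A card_B by simp
qed

section \<open>Forms whose solutions are divisible by 5\<close>

lemma five_dvd_square_iff: "5 dvd x\<^sup>2 \<longleftrightarrow> 5 dvd x" for x :: int
  by (rule prime_dvd_power_iff) simp_all

text \<open>As 5 is 1 modulo 4 and prime to 3, scaling by 5 respects the residue conditions on the
  variables.\<close>

lemma mult_5_residues: "(5 * x) mod 4 = x mod 4" "3 dvd 5 * x \<longleftrightarrow> 3 dvd x" for x :: int
  by presburger+

text \<open>Modulo 5 the equation gives \<open>x = 5 z\<close>; dividing it by 5 leaves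
  \<open>3 y^2 + 10 z^2 = n\<close>, with the variables exchanged.\<close>

lemma card_form_2_15:
  fixes n :: int
  shows "card {(x::int, y). x mod 4 = 1 \<and> \<not> 3 dvd x \<and> y mod 4 = 1 \<and> \<not> 3 dvd y \<and>
      2 * x\<^sup>2 + 15 * y\<^sup>2 = 5 * n} =
    card {(x::int, y). x mod 4 = 1 \<and> \<not> 3 dvd x \<and> y mod 4 = 1 \<and> \<not> 3 dvd y \<and>
      3 * x\<^sup>2 + 10 * y\<^sup>2 = n}" (is "card ?A = card ?B")
proof -
  have "bij_betw (\<lambda>(x, y). (5 * y, x)) ?B ?A"
  proof (rule bij_betw_byWitness[where f' = "\<lambda>(x, y). (y, x div 5)"])
    have *: "\<exists>z. x = 5 * z" if "2 * x\<^sup>2 + 15 * y\<^sup>2 = 5 * n" for x y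
    proof -
      have "2 * x\<^sup>2 = 5 * (n - 3 * y\<^sup>2)" using that by simp
      then have "5 dvd 2 * x\<^sup>2" by simp
      then have "5 dvd x" by (auto simp: prime_dvd_mult_iff five_dvd_square_iff)
      then show ?thesis by blast
    qed
    show "(\<lambda>(x, y). (5 * y, x)) ` ?B \<subseteq> ?A"
      by (auto simp: mult_5_residues power_mult_distrib)
    show "(\<lambda>(x, y). (y, x div 5)) ` ?A \<subseteq> ?B"
    proof -
      have "(y, x div 5) \<in> ?B" if xy: "(x, y) \<in> ?A" for x y
      proof -
        obtain z where "x = 5 * z" using * xy by blast
        then show ?thesis using xy by (auto simp: mult_5_residues power_mult_distrib)
      qed
      then show ?thesis by auto
    qed
    show "\<forall>a\<in>?A. (\<lambda>(x, y). (5 * y, x)) ((\<lambda>(x, y). (y, x div 5)) a) = a"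
      using * by fastforce
  qed auto
  then show ?thesis by (simp add: bij_betw_same_card)
qed

text \<open>The equation modulo 5 shows that 5 divides \<open>x\<close>; then 25 divides
  \<open>10 y^2\<close>, so 5 divides \<open>y\<close> too.\<close>

lemma card_form_3_10:
  fixes n :: int
  shows "card {(x::int, y). x mod 4 = 1 \<and> \<not> 3 dvd x \<and> y mod 4 = 1 \<and> \<not> 3 dvd y \<and>
      3 * x\<^sup>2 + 10 * y\<^sup>2 = 25 * n} =
    card {(x::int, y). x mod 4 = 1 \<and> \<not> 3 dvd x \<and> y mod 4 = 1 \<and> \<not> 3 dvd y \<and>
      3 * x\<^sup>2 + 10 * y\<^sup>2 = n}" (is "card ?A = card ?B")
proof -
  have "bij_betw (\<lambda>(x, y). (5 * x, 5 * y)) ?B ?A"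
  proof (rule bij_betw_byWitness[where f' = "\<lambda>(x, y). (x div 5, y div 5)"])
    have *: "\<exists>z w. x = 5 * z \<and> y = 5 * w" if "3 * x\<^sup>2 + 10 * y\<^sup>2 = 25 * n" for x y
    proof -
      have "3 * x\<^sup>2 = 5 * (5 * n - 2 * y\<^sup>2)" using that by simp
      then have "5 dvd 3 * x\<^sup>2" by simp
      then have "5 dvd x" by (auto simp: prime_dvd_mult_iff five_dvd_square_iff)
      then obtain z where z: "x = 5 * z" by blast
      have "2 * y\<^sup>2 = 5 * (n - 3 * z\<^sup>2)" using that z by (simp add: power_mult_distrib)
      then have "5 dvd 2 * y\<^sup>2" by simp
      then have "5 dvd y" by (auto simp: prime_dvd_mult_iff five_dvd_square_iff)
      then show ?thesis using z by blast
    qed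
    show "(\<lambda>(x, y). (5 * x, 5 * y)) ` ?B \<subseteq> ?A"
      by (auto simp: mult_5_residues power_mult_distrib)
    show "(\<lambda>(x, y). (x div 5, y div 5)) ` ?A \<subseteq> ?B"
    proof clarify
      fix x y assume xy: "x mod 4 = 1" "\<not> 3 dvd x" "y mod 4 = 1" "\<not> 3 dvd y" "3 * x\<^sup>2 + 10 * y\<^sup>2 = 25 * n"
      obtain z w where "x = 5 * z" "y = 5 * w" using * xy(5) by blast
      then show "x div 5 mod 4 = 1 \<and> \<not> 3 dvd x div 5 \<and> y div 5 mod 4 = 1 \<and> \<not> 3 dvd y div 5 \<and>
          3 * (x div 5)\<^sup>2 + 10 * (y div 5)\<^sup>2 = n"
        using xy by (auto simp: mult_5_residues power_mult_distrib)
    qed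
    show "\<forall>a\<in>?A. (\<lambda>(x, y). (5 * x, 5 * y)) ((\<lambda>(x, y). (x div 5, y div 5)) a) = a"
      using * by fastforce
  qed auto
  then show ?thesis by (simp add: bij_betw_same_card)
qed

section \<open>Power series over the field with two elements\<close>

text \<open>Coefficients are parities of fibre sizes. An infinite fibre would be counted as 0, hence
  the finiteness hypotheses of \<open>theta_mult\<close>.\<close>

definition theta :: "'b set \<Rightarrow> ('b \<Rightarrow> nat) \<Rightarrow> bit fps" where
  "theta I e = Abs_fps (\<lambda>n. of_nat (card {x \<in> I. e x = n}))"

lemma theta_nth [simp]: "fps_nth (theta I e) n = of_nat (card {x \<in> I. e x = n})"
  by (simp add: theta_def)

lemma theta_mult:
  assumes "\<And>n. finite {x \<in> I. d x = n}" "\<And>n. finite {y \<in> J. e y = n}"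
  shows "theta I d * theta J e = theta (I \<times> J) (\<lambda>(x, y). d x + e y)"
proof (rule fps_ext)
  fix n
  let ?A = "\<lambda>i. {x \<in> I. d x = i} \<times> {y \<in> J. e y = n - i}"
  have "{p \<in> I \<times> J. (case p of (x, y) \<Rightarrow> d x + e y) = n} = (\<Union>i\<in>{0..n}. ?A i)" by auto
  moreover have "card (\<Union>i\<in>{0..n}. ?A i) = (\<Sum>i=0..n. card (?A i))"
    by (rule card_UN_disjoint) (use assms in auto)
  ultimately show "fps_nth (theta I d * theta J e) n = fps_nth (theta (I \<times> J) (\<lambda>(x, y). d x + e y)) n"
    by (simp add: fps_mult_nth card_cartesian_product)
qed

lemma fps_nth_compose_X_power:
  fixes f :: "'a :: comm_ring_1 fps"
  assumes "i > 0"
  shows "fps_nth (f oo fps_X ^ i) n = (if i dvd n then fps_nth f (n div i) else 0)"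
proof -
  have "fps_nth (f oo fps_X ^ i) n = (\<Sum>j=0..n. if n = i * j then fps_nth f j else 0)"
    by (simp add: fps_compose_nth fps_X_power_nth power_mult [symmetric] if_distrib cong: if_cong)
  also have "\<dots> = (\<Sum>j=0..n. if j = n div i then if i dvd n then fps_nth f (n div i) else 0 else 0)"
    using assms by (intro sum.cong) auto
  also have "\<dots> = (if i dvd n then fps_nth f (n div i) else 0)"
    by (simp add: div_le_dividend)
  finally show ?thesis .
qed

lemma theta_compose:
  assumes "i > 0"
  shows "theta I e oo fps_X ^ i = theta I (\<lambda>x. i * e x)"
proof (rule fps_ext)
  fix n
  have "{x \<in> I. i * e x = n} = (if i dvd n then {x \<in> I. e x = n div i} else {})"
    using assms by auto
  then show "fps_nth (theta I e oo fps_X ^ i) n = fps_nth (theta I (\<lambda>x. i * e x)) n"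
    using assms by (simp add: fps_nth_compose_X_power)
qed

section \<open>Frobenius and 2-dissection in characteristic 2\<close>

lemma fps_bit_power2_nth:
  fixes f :: "bit fps"
  shows "fps_nth (f\<^sup>2) n = (if even n then fps_nth f (n div 2) else 0)"
proof -
  let ?t = "\<lambda>i. fps_nth f i * fps_nth f (n - i)"
  \<comment> \<open>The terms for \<open>i\<close> and \<open>n - i\<close> cancel, so only the
    diagonal term survives, and there \<open>c * c = c\<close>.\<close>
  have *: "(\<Sum>i\<in>{i \<in> {0..n}. 2 * i \<noteq> n}. ?t i) = 0"
  proof (rule sum_involution_eq_0[where h = "\<lambda>i. n - i"])
    fix i assume "i \<in> {i \<in> {0..n}. 2 * i \<noteq> n}"
    then have "n - (n - i) = i" by simp
    moreover have "c + c = 0" for c :: bit by (cases c) simp_all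
    ultimately show "?t (n - i) + ?t i = 0" by (simp add: mult.commute)
  qed auto
  have "fps_nth (f\<^sup>2) n = (\<Sum>i\<in>{0..n}. ?t i)"
    by (simp add: power2_eq_square fps_mult_nth)
  also have "{0..n} = {i \<in> {0..n}. 2 * i \<noteq> n} \<union> {i \<in> {0..n}. 2 * i = n}" by auto
  also have "sum ?t \<dots> = sum ?t {i \<in> {0..n}. 2 * i = n}"
    by (subst sum.union_disjoint) (use * in auto)
  also have "{i \<in> {0..n}. 2 * i = n} = (if even n then {n div 2} else {})" by auto
  also have "sum ?t \<dots> = (if even n then fps_nth f (n div 2) else 0)"
  proof (cases "even n")
    case True
    then have "n - n div 2 = n div 2" by presburger
    moreover have "c * c = c" for c :: bit by (cases c) simp_all
    ultimately show ?thesis using True by simp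
  qed simp
  finally show ?thesis .
qed

lemma fps_bit_power2: "f\<^sup>2 = f oo fps_X\<^sup>2" for f :: "bit fps"
  by (rule fps_ext) (simp add: fps_nth_compose_X_power fps_bit_power2_nth)

lemma fps_bit_add_self [simp]: "f + f = 0" for f :: "bit fps"
proof (rule fps_ext)
  have "c + c = 0" for c :: bit by (cases c) simp_all
  then show "fps_nth (f + f) n = fps_nth 0 n" for n by simp
qed

lemma fps_bit_power2_add: "(f + g)\<^sup>2 = f\<^sup>2 + g\<^sup>2" for f g :: "bit fps"
  by (simp only: fps_bit_power2[of "f + g"] fps_bit_power2[of f] fps_bit_power2[of g] fps_compose_add_distrib)

definition bisect :: "nat \<Rightarrow> bit fps \<Rightarrow> bit fps" where
  "bisect r f = Abs_fps (\<lambda>n. fps_nth f (2 * n + r))"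

lemma bisect_nth [simp]: "fps_nth (bisect r f) n = fps_nth f (2 * n + r)"
  by (simp add: bisect_def)

text \<open>Over two elements the square of a series is the series in \<open>q^2\<close>, so the
  even and odd parts can be written with squares instead of substitutions.\<close>

lemma bisect_decomposition: "f = (bisect 0 f)\<^sup>2 + fps_X * (bisect 1 f)\<^sup>2"
  by (rule fps_ext) (auto simp: fps_bit_power2_nth elim!: evenE oddE)

lemma bisect_dissected:
  "bisect 0 (f\<^sup>2 + fps_X * g\<^sup>2) = f" "bisect 1 (f\<^sup>2 + fps_X * g\<^sup>2) = g"
  by (rule fps_ext; simp add: fps_bit_power2_nth)+

text \<open>A square is a series in \<open>q^2\<close>, so it leaves a bisection as its root. This
  is what makes repeated dissection of a quotient possible.\<close>

lemma bisect_square_mult: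
  "bisect 0 (f\<^sup>2 * g) = f * bisect 0 g" "bisect 1 (f\<^sup>2 * g) = f * bisect 1 g"
proof -
  have "f\<^sup>2 * g = (f * bisect 0 g)\<^sup>2 + fps_X * (f * bisect 1 g)\<^sup>2"
    by (subst bisect_decomposition[of g]) (simp add: algebra_simps)
  then show "bisect 0 (f\<^sup>2 * g) = f * bisect 0 g" "bisect 1 (f\<^sup>2 * g) = f * bisect 1 g"
    by (simp_all only: bisect_dissected)
qed

lemma bisect_0_X_mult: "bisect 0 (fps_X * f) = fps_X * bisect 1 f"
  by (rule fps_ext) (auto simp: gr0_conv_Suc)

section \<open>Theta series\<close>

text \<open>The condition \<open>x mod 4 = 1\<close> selects one of \<open>\<plusminus>x\<close>, so the exponents below run once through the
  generalised pentagonal numbers and the triangular numbers, respectively.\<close>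

definition eta :: "nat \<Rightarrow> bit fps" where
  "eta i = theta {x::int. x mod 4 = 1 \<and> \<not> 3 dvd x} (\<lambda>x. i * nat ((x\<^sup>2 - 1) div 24))"

definition psi :: "nat \<Rightarrow> bit fps" where
  "psi i = theta {y::int. y mod 4 = 1} (\<lambda>y. i * nat ((y\<^sup>2 - 1) div 8))"

text \<open>The square of a number prime to 6 is 1 modulo 24, so \<open>div\<close> and
  \<open>nat\<close> are exact in \<open>eta\<close>.\<close>

lemma pentagonal_exponent:
  assumes "odd x" "\<not> 3 dvd x"
  shows "x\<^sup>2 = 24 * int (nat ((x\<^sup>2 - 1) div 24)) + 1"
proof -
  have "\<exists>k. x = 12 * k + 1 \<or> x = 12 * k + 5 \<or> x = 12 * k + 7 \<or> x = 12 * k + 11"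
    using assms by presburger
  then obtain k where "x = 12 * k + 1 \<or> x = 12 * k + 5 \<or> x = 12 * k + 7 \<or> x = 12 * k + 11" ..
  then have "\<exists>j. x\<^sup>2 - 1 = 24 * j"
  proof (elim disjE)
    assume "x = 12 * k + 1"
    then show ?thesis by (intro exI[of _ "6 * k\<^sup>2 + k"]) (simp add: power2_eq_square algebra_simps)
  next
    assume "x = 12 * k + 5"
    then show ?thesis by (intro exI[of _ "6 * k\<^sup>2 + 5 * k + 1"]) (simp add: power2_eq_square algebra_simps)
  next
    assume "x = 12 * k + 7"
    then show ?thesis by (intro exI[of _ "6 * k\<^sup>2 + 7 * k + 2"]) (simp add: power2_eq_square algebra_simps)
  next
    assume "x = 12 * k + 11"
    then show ?thesis by (intro exI[of _ "6 * k\<^sup>2 + 11 * k + 5"]) (simp add: power2_eq_square algebra_simps)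
  qed
  then obtain j where j: "x\<^sup>2 - 1 = 24 * j" ..
  have "x \<noteq> 0" using assms by auto
  then have "x\<^sup>2 > 0" by simp
  then have "j \<ge> 0" using j by linarith
  then show ?thesis using j by simp
qed

lemma triangular_exponent:
  assumes "odd y"
  shows "y\<^sup>2 = 8 * int (nat ((y\<^sup>2 - 1) div 8)) + 1"
proof -
  have "\<exists>k. y = 4 * k + 1 \<or> y = 4 * k + 3" using assms by presburger
  then obtain k where "y = 4 * k + 1 \<or> y = 4 * k + 3" ..
  then have "\<exists>j. y\<^sup>2 - 1 = 8 * j"
  proof (elim disjE)
    assume "y = 4 * k + 1"
    then show ?thesis by (intro exI[of _ "2 * k\<^sup>2 + k"]) (simp add: power2_eq_square algebra_simps)
  next
    assume "y = 4 * k + 3"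
    then show ?thesis by (intro exI[of _ "2 * k\<^sup>2 + 3 * k + 1"]) (simp add: power2_eq_square algebra_simps)
  qed
  then obtain j where j: "y\<^sup>2 - 1 = 8 * j" ..
  have "y \<noteq> 0" using assms by auto
  then have "y\<^sup>2 > 0" by simp
  then have "j \<ge> 0" using j by linarith
  then show ?thesis using j by simp
qed

lemma odd_of_mod: "x mod 4 = 1 \<Longrightarrow> odd x" "x mod 6 = 1 \<Longrightarrow> odd x" "x mod 6 = 1 \<Longrightarrow> \<not> 3 dvd x" for x :: int
  by presburger+

lemma pentagonal_exponent_iff:
  assumes "odd x" "\<not> 3 dvd x"
  shows "nat ((x\<^sup>2 - 1) div 24) = n \<longleftrightarrow> x\<^sup>2 = 24 * int n + 1"
  using pentagonal_exponent[OF assms] by (intro iffI; linarith)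

lemma finite_pentagonal_fibre:
  assumes "i > 0" "\<And>x. x \<in> I \<Longrightarrow> odd x \<and> \<not> 3 dvd x"
  shows "finite {x \<in> I. i * nat ((x\<^sup>2 - 1) div 24) = n}"
proof (rule finite_subset[OF _ finite_int_square_eq])
  show "{x \<in> I. i * nat ((x\<^sup>2 - 1) div 24) = n} \<subseteq> {x. x\<^sup>2 = 24 * int (n div i) + 1}"
  proof safe
    fix x assume "x \<in> I"
    then show "x\<^sup>2 = 24 * int (i * nat ((x\<^sup>2 - 1) div 24) div i) + 1"
      using assms pentagonal_exponent[of x] by simp
  qed
qed

lemma finite_triangular_fibre:
  assumes "i > 0" "\<And>y. y \<in> I \<Longrightarrow> odd y"
  shows "finite {y \<in> I. i * nat ((y\<^sup>2 - 1) div 8) = n}"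
proof (rule finite_subset[OF _ finite_int_square_eq])
  show "{y \<in> I. i * nat ((y\<^sup>2 - 1) div 8) = n} \<subseteq> {y. y\<^sup>2 = 8 * int (n div i) + 1}"
  proof safe
    fix y assume "y \<in> I"
    then show "y\<^sup>2 = 8 * int (i * nat ((y\<^sup>2 - 1) div 8) div i) + 1"
      using assms triangular_exponent[of y] by simp
  qed
qed

lemma eta_compose: "j > 0 \<Longrightarrow> eta i oo fps_X ^ j = eta (j * i)"
  unfolding eta_def by (simp add: theta_compose mult.assoc)

lemma psi_compose: "j > 0 \<Longrightarrow> psi i oo fps_X ^ j = psi (j * i)"
  unfolding psi_def by (simp add: theta_compose mult.assoc)

lemma eta_power2: "(eta i)\<^sup>2 = eta (2 * i)"
  unfolding fps_bit_power2[of "eta i"] by (rule eta_compose) simp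

lemma eta_power4: "eta i ^ 4 = eta (4 * i)"
proof -
  have "eta i ^ 4 = ((eta i)\<^sup>2)\<^sup>2" by (simp flip: power_mult)
  then show ?thesis by (simp add: eta_power2)
qed

lemma eta_mult_nth:
  assumes "i > 0" "j > 0"
  shows "fps_nth (eta i * eta j) n = of_nat (card {(x::int, y). x mod 4 = 1 \<and> \<not> 3 dvd x \<and>
    y mod 4 = 1 \<and> \<not> 3 dvd y \<and> int i * x\<^sup>2 + int j * y\<^sup>2 = 24 * int n + int i + int j})"
proof -
  have "(i * nat ((x\<^sup>2 - 1) div 24) + j * nat ((y\<^sup>2 - 1) div 24) = n) \<longleftrightarrow>
      int i * x\<^sup>2 + int j * y\<^sup>2 = 24 * int n + int i + int j"
    if "x mod 4 = 1" "\<not> 3 dvd x" "y mod 4 = 1" "\<not> 3 dvd y" for x y :: int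
  proof -
    define a where "a = nat ((x\<^sup>2 - 1) div 24)"
    define b where "b = nat ((y\<^sup>2 - 1) div 24)"
    have "x\<^sup>2 = 24 * int a + 1" "y\<^sup>2 = 24 * int b + 1"
      using pentagonal_exponent[of x] pentagonal_exponent[of y] that by (simp_all add: a_def b_def odd_of_mod)
    then have "int i * x\<^sup>2 + int j * y\<^sup>2 = 24 * int (i * a + j * b) + int i + int j"
      by (simp add: algebra_simps)
    moreover define k where "k = i * a + j * b"
    ultimately have "int i * x\<^sup>2 + int j * y\<^sup>2 = 24 * int k + int i + int j" by simp
    then show ?thesis unfolding a_def[symmetric] b_def[symmetric] k_def[symmetric] by simp
  qed
  then have "{p \<in> {x::int. x mod 4 = 1 \<and> \<not> 3 dvd x} \<times> {x. x mod 4 = 1 \<and> \<not> 3 dvd x}.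
      (case p of (x, y) \<Rightarrow> i * nat ((x\<^sup>2 - 1) div 24) + j * nat ((y\<^sup>2 - 1) div 24)) = n} =
    {(x, y). x mod 4 = 1 \<and> \<not> 3 dvd x \<and>
      y mod 4 = 1 \<and> \<not> 3 dvd y \<and> int i * x\<^sup>2 + int j * y\<^sup>2 = 24 * int n + int i + int j}"
    by auto
  moreover have "finite {x \<in> {x::int. x mod 4 = 1 \<and> \<not> 3 dvd x}. i * nat ((x\<^sup>2 - 1) div 24) = n}" if "i > 0" for i n
    using that by (rule finite_pentagonal_fibre) (simp add: odd_of_mod)
  ultimately show ?thesis
    unfolding eta_def using assms by (simp only: theta_mult theta_nth)
qed

text \<open>After cancelling \<open>eta 1\<close> this is Jacobi's formula for the cube of the Euler
  product modulo 2. The exponent equation is \<open>x^2 + 3 y^2 = 4 M\<close> with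
  \<open>M = 6 n + 1\<close>, for which only the squares \<open>u^2 = M\<close> remain, and they
  generate \<open>eta 4\<close>.\<close>

lemma eta_mult_psi: "eta 1 * psi 1 = eta 1 ^ 4"
proof (rule fps_ext)
  fix n
  let ?I = "{x::int. x mod 4 = 1 \<and> \<not> 3 dvd x}" and ?J = "{y::int. y mod 4 = 1}"
  have *: "(nat ((x\<^sup>2 - 1) div 24) + nat ((y\<^sup>2 - 1) div 8) = n) \<longleftrightarrow> x\<^sup>2 + 3 * y\<^sup>2 = 4 * (6 * int n + 1)"
    if "odd x" "\<not> 3 dvd x" "odd y" for x y :: int
  proof -
    define a where "a = nat ((x\<^sup>2 - 1) div 24)"
    define b where "b = nat ((y\<^sup>2 - 1) div 8)"
    have "x\<^sup>2 = 24 * int a + 1" "y\<^sup>2 = 8 * int b + 1"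
      unfolding a_def b_def by (intro pentagonal_exponent triangular_exponent that)+
    then show ?thesis unfolding a_def[symmetric] b_def[symmetric] by presburger
  qed
  have 3: "\<not> 3 dvd x" if "x\<^sup>2 + 3 * y\<^sup>2 = 4 * (6 * int n + 1)" for x y :: int
  proof -
    have "x\<^sup>2 = 3 * (8 * int n + 1 - y\<^sup>2) + 1" using that by simp
    then have "\<not> 3 dvd x\<^sup>2" by presburger
    then show ?thesis by (simp add: three_dvd_square_iff)
  qed
  have finI: "finite {x \<in> ?I. 1 * nat ((x\<^sup>2 - 1) div 24) = n}" for n
    by (rule finite_pentagonal_fibre) (simp_all add: odd_of_mod)
  have finJ: "finite {y \<in> ?J. 1 * nat ((y\<^sup>2 - 1) div 8) = n}" for n
    by (rule finite_triangular_fibre) (simp_all add: odd_of_mod)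
  have "{p \<in> ?I \<times> ?J. (case p of (x, y) \<Rightarrow> 1 * nat ((x\<^sup>2 - 1) div 24) + 1 * nat ((y\<^sup>2 - 1) div 8)) = n} =
    {(x, y). x mod 4 = 1 \<and> y mod 4 = 1 \<and> x\<^sup>2 + 3 * y\<^sup>2 = 4 * (6 * int n + 1)}"
  proof (rule set_eqI)
    fix p :: "int \<times> int"
    obtain x y where p: "p = (x, y)" by (cases p)
    have "((x mod 4 = 1 \<and> \<not> 3 dvd x) \<and> y mod 4 = 1) \<and>
        1 * nat ((x\<^sup>2 - 1) div 24) + 1 * nat ((y\<^sup>2 - 1) div 8) = n \<longleftrightarrow>
      x mod 4 = 1 \<and> y mod 4 = 1 \<and> x\<^sup>2 + 3 * y\<^sup>2 = 4 * (6 * int n + 1)"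
      unfolding mult_1 using *[of x y] 3[of x y] odd_of_mod(1) by blast
    then show "p \<in> {p \<in> ?I \<times> ?J. (case p of (x, y) \<Rightarrow> 1 * nat ((x\<^sup>2 - 1) div 24) + 1 * nat ((y\<^sup>2 - 1) div 8)) = n}
      \<longleftrightarrow> p \<in> {(x, y). x mod 4 = 1 \<and> y mod 4 = 1 \<and> x\<^sup>2 + 3 * y\<^sup>2 = 4 * (6 * int n + 1)}"
      unfolding p by (simp only: mem_Collect_eq mem_Sigma_iff prod.case)
  qed
  then have "fps_nth (eta 1 * psi 1) n =
      of_nat (card {(x::int, y). x mod 4 = 1 \<and> y mod 4 = 1 \<and> x\<^sup>2 + 3 * y\<^sup>2 = 4 * (6 * int n + 1)})"
    unfolding eta_def psi_def using finI finJ by (simp only: theta_mult theta_nth)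
  also have "\<dots> = of_nat (card {u. u mod 4 = 1 \<and> u\<^sup>2 = 6 * int n + 1}) +
      of_nat (card {v. v mod 4 = 1 \<and> 3 * v\<^sup>2 = 6 * int n + 1})"
    by (rule card_eisenstein_form) simp
  also have "{v. v mod 4 = 1 \<and> 3 * v\<^sup>2 = 6 * int n + 1} = {}"
  proof -
    have "3 * v\<^sup>2 \<noteq> 6 * int n + 1" for v by presburger
    then show ?thesis by auto
  qed
  also have "{u. u mod 4 = 1 \<and> u\<^sup>2 = 6 * int n + 1} = {x \<in> ?I. 4 * nat ((x\<^sup>2 - 1) div 24) = n}"
  proof -
    have "\<not> 3 dvd u" if "u\<^sup>2 = 6 * int n + 1" for u
    proof -
      have "\<not> 3 dvd u\<^sup>2" using that by presburger
      then show ?thesis by (simp add: three_dvd_square_iff)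
    qed
    moreover have "4 * nat ((x\<^sup>2 - 1) div 24) = n \<longleftrightarrow> x\<^sup>2 = 6 * int n + 1" if "odd x" "\<not> 3 dvd x" for x
      using pentagonal_exponent[OF that] by (intro iffI; linarith)
    ultimately show ?thesis unfolding mem_Collect_eq using odd_of_mod(1) by (intro Collect_cong) blast
  qed
  finally show "fps_nth (eta 1 * psi 1) n = fps_nth (eta 1 ^ 4) n"
    unfolding eta_power4 by (simp add: eta_def)
qed

lemma eta_nth_0: "i > 0 \<Longrightarrow> fps_nth (eta i) 0 = 1"
proof -
  assume "i > 0"
  have "{x::int. x mod 4 = 1 \<and> \<not> 3 dvd x \<and> nat ((x\<^sup>2 - 1) div 24) = 0} = {1}"
  proof -
    have "x = 1" if "x mod 4 = 1" "\<not> 3 dvd x" "nat ((x\<^sup>2 - 1) div 24) = 0" for x :: int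
    proof -
      have "x\<^sup>2 = 1" using that pentagonal_exponent_iff[of x 0] odd_of_mod(1)[of x] by simp
      then show ?thesis using that(1) by (auto simp: power2_eq_1_iff)
    qed
    then show ?thesis by auto
  qed
  then show ?thesis using \<open>i > 0\<close> by (simp add: eta_def)
qed

lemma eta_neq_0: "i > 0 \<Longrightarrow> eta i \<noteq> 0"
  using eta_nth_0[of i] by auto

lemma psi_eq_eta_power3: "i > 0 \<Longrightarrow> psi i = eta i ^ 3"
proof -
  assume i: "i > 0"
  have "eta 1 * psi 1 = eta 1 * eta 1 ^ 3"
    using eta_mult_psi by (simp add: power_numeral_reduce)
  then have "psi 1 = eta 1 ^ 3" using eta_neq_0[of 1] by simp
  then have "psi 1 oo fps_X ^ i = (eta 1 oo fps_X ^ i) ^ 3"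
    using i by (simp add: fps_compose_power[symmetric] fps_X_power_nth)
  then show ?thesis using i by (simp add: eta_compose psi_compose)
qed

text \<open>By Jacobi's formula the cubes are \<open>psi\<close> series. Their product counts
  \<open>x^2 + 3 y^2 = 4 (2 n + 1)\<close>, and the two kinds of surviving solutions give the two
  terms.\<close>

lemma eta_1_3_dissection: "eta 1 ^ 3 * eta 3 ^ 3 = eta 4 ^ 3 + fps_X * eta 12 ^ 3"
proof -
  have "psi 1 * psi 3 = psi 4 + fps_X * psi 12"
  proof (rule fps_ext)
    fix n
    let ?J = "{y::int. y mod 4 = 1}"
    have *: "(nat ((x\<^sup>2 - 1) div 8) + 3 * nat ((y\<^sup>2 - 1) div 8) = n) \<longleftrightarrow> x\<^sup>2 + 3 * y\<^sup>2 = 4 * (2 * int n + 1)"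
      if "odd x" "odd y" for x y :: int
    proof -
    define a where "a = nat ((x\<^sup>2 - 1) div 8)"
    define b where "b = nat ((y\<^sup>2 - 1) div 8)"
    have "x\<^sup>2 = 8 * int a + 1" "y\<^sup>2 = 8 * int b + 1"
      unfolding a_def b_def by (intro triangular_exponent  that)+
    then show ?thesis unfolding a_def[symmetric] b_def[symmetric] by presburger
  qed
    have fin: "finite {y \<in> ?J. 1 * nat ((y\<^sup>2 - 1) div 8) = n}" "finite {y \<in> ?J. 3 * nat ((y\<^sup>2 - 1) div 8) = n}" for n
      by (rule finite_triangular_fibre; simp add: odd_of_mod)+
    have "{p \<in> ?J \<times> ?J. (case p of (x, y) \<Rightarrow> 1 * nat ((x\<^sup>2 - 1) div 8) + 3 * nat ((y\<^sup>2 - 1) div 8)) = n} =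
      {(x, y). x mod 4 = 1 \<and> y mod 4 = 1 \<and> x\<^sup>2 + 3 * y\<^sup>2 = 4 * (2 * int n + 1)}"
    proof (rule set_eqI)
      fix p :: "int \<times> int"
      obtain x y where p: "p = (x, y)" by (cases p)
      have "(x mod 4 = 1 \<and> y mod 4 = 1) \<and>
          1 * nat ((x\<^sup>2 - 1) div 8) + 3 * nat ((y\<^sup>2 - 1) div 8) = n \<longleftrightarrow>
        x mod 4 = 1 \<and> y mod 4 = 1 \<and> x\<^sup>2 + 3 * y\<^sup>2 = 4 * (2 * int n + 1)"
        unfolding mult_1 using *[of x y] odd_of_mod(1) by blast
      then show "p \<in> {p \<in> ?J \<times> ?J. (case p of (x, y) \<Rightarrow> 1 * nat ((x\<^sup>2 - 1) div 8) + 3 * nat ((y\<^sup>2 - 1) div 8)) = n}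
        \<longleftrightarrow> p \<in> {(x, y). x mod 4 = 1 \<and> y mod 4 = 1 \<and> x\<^sup>2 + 3 * y\<^sup>2 = 4 * (2 * int n + 1)}"
        unfolding p by (simp only: mem_Collect_eq mem_Sigma_iff prod.case)
    qed
    then have "fps_nth (psi 1 * psi 3) n =
        of_nat (card {(x::int, y). x mod 4 = 1 \<and> y mod 4 = 1 \<and> x\<^sup>2 + 3 * y\<^sup>2 = 4 * (2 * int n + 1)})"
      unfolding psi_def using fin by (simp only: theta_mult theta_nth)
    also have "\<dots> = of_nat (card {u. u mod 4 = 1 \<and> u\<^sup>2 = 2 * int n + 1}) +
        of_nat (card {v. v mod 4 = 1 \<and> 3 * v\<^sup>2 = 2 * int n + 1})"
      by (rule card_eisenstein_form) simp
    also have "{u. u mod 4 = 1 \<and> u\<^sup>2 = 2 * int n + 1} = {y \<in> ?J. 4 * nat ((y\<^sup>2 - 1) div 8) = n}"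
    proof -
      have "4 * nat ((y\<^sup>2 - 1) div 8) = n \<longleftrightarrow> y\<^sup>2 = 2 * int n + 1" if "odd y" for y
        using triangular_exponent[OF that] by (intro iffI; linarith)
      then show ?thesis unfolding mem_Collect_eq using odd_of_mod(1) by (intro Collect_cong) blast
    qed
    also have "{v. v mod 4 = 1 \<and> 3 * v\<^sup>2 = 2 * int n + 1} = {y \<in> ?J. 12 * nat ((y\<^sup>2 - 1) div 8) + 1 = n}"
    proof -
      have "12 * nat ((y\<^sup>2 - 1) div 8) + 1 = n \<longleftrightarrow> 3 * y\<^sup>2 = 2 * int n + 1" if "odd y" for y
        using triangular_exponent[OF that] by (intro iffI; linarith)
      then show ?thesis unfolding mem_Collect_eq using odd_of_mod(1) by (intro Collect_cong) blast
    qed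
    also have "(of_nat (card {y \<in> ?J. 12 * nat ((y\<^sup>2 - 1) div 8) + 1 = n}) :: bit) = fps_nth (fps_X * psi 12) n"
      by (cases n) (simp_all add: psi_def)
    finally show "fps_nth (psi 1 * psi 3) n = fps_nth (psi 4 + fps_X * psi 12) n"
      by (simp add: psi_def)
  qed
  then show ?thesis by (simp add: psi_eq_eta_power3)
qed

text \<open>With \<open>x = 6 k + 1\<close> the exponent is \<open>k (3 k + 1) / 2\<close>, the
  usual indexing of the pentagonal numbers. This normalisation also suits division by
  \<open>1 + \<surd>-5\<close>.\<close>

lemma eta_1_conv_mod_6: "eta 1 = theta {x::int. x mod 6 = 1} (\<lambda>x. nat ((x\<^sup>2 - 1) div 24))"
proof (rule fps_ext)
  fix n
  have "\<not> 3 dvd x" if "1 * x\<^sup>2 = 24 * int n + 1" for x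
  proof -
    have "\<not> 3 dvd x\<^sup>2" using that by presburger
    then show ?thesis by (simp add: three_dvd_square_iff)
  qed
  then have "{x::int. (x mod 4 = 1 \<and> \<not> 3 dvd x) \<and> nat ((x\<^sup>2 - 1) div 24) = n} =
      {x. x mod 4 = 1 \<and> 1 * x\<^sup>2 = 24 * int n + 1}"
    unfolding mult_1 using pentagonal_exponent_iff[of _ n] odd_of_mod(1) by (intro Collect_cong) blast
  moreover have "{x::int. x mod 6 = 1 \<and> nat ((x\<^sup>2 - 1) div 24) = n} = {x. x mod 6 = 1 \<and> 1 * x\<^sup>2 = 24 * int n + 1}"
    unfolding mult_1 using pentagonal_exponent_iff[of _ n] odd_of_mod(2,3) by (intro Collect_cong) blast
  moreover have "card {x. x mod 6 = 1 \<and> 1 * x\<^sup>2 = 24 * int n + 1} = card {x. x mod 4 = 1 \<and> 1 * x\<^sup>2 = 24 * int n + 1}"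
    by (rule card_square_residue_change) presburger+
  ultimately show "fps_nth (eta 1) n = fps_nth (theta {x::int. x mod 6 = 1} (\<lambda>x. nat ((x\<^sup>2 - 1) div 24))) n"
    unfolding eta_def by simp
qed

text \<open>Division by \<open>1 + \<surd>-5\<close> in \<open>\<int>[\<surd>-5]\<close>.\<close>

lemma card_disc20_form_div_6:
  fixes M :: int
  shows "card {(x::int, y). x mod 6 = 1 \<and> y mod 6 = 1 \<and> x\<^sup>2 + 5 * y\<^sup>2 = 6 * M} =
    card {(u::int, v). (u + v) mod 6 = 1 \<and> u\<^sup>2 + 5 * v\<^sup>2 = M}" (is "card ?A = card ?U")
proof -
  have "bij_betw (\<lambda>(u, v). (u - 5 * v, u + v)) ?U ?A"
  proof (rule bij_betw_byWitness[where f' = "\<lambda>(x, y). (y - (y - x) div 6, (y - x) div 6)"])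
    show "(\<lambda>(u, v). (u - 5 * v, u + v)) ` ?U \<subseteq> ?A"
    proof -
      have "(u - 5 * v) mod 6 = (u + v) mod 6" for u v :: int
        using mod_mult_self2[of "u + v" 6 "- v"] by (simp add: algebra_simps)
      moreover have "(u - 5 * v)\<^sup>2 + 5 * (u + v)\<^sup>2 = 6 * (u\<^sup>2 + 5 * v\<^sup>2)" for u v :: int
        by (simp add: power2_eq_square algebra_simps)
      ultimately show ?thesis by (simp add: image_subset_iff)
    qed
    have *: "\<exists>v. y = x + 6 * v" if "x mod 6 = 1" "y mod 6 = 1" for x y :: int
      using that by presburger
    show "(\<lambda>(x, y). (y - (y - x) div 6, (y - x) div 6)) ` ?A \<subseteq> ?U"
      using * by (fastforce simp: power2_eq_square algebra_simps)
    show "\<forall>a\<in>?A. (\<lambda>(u, v). (u - 5 * v, u + v)) ((\<lambda>(x, y). (y - (y - x) div 6, (y - x) div 6)) a) = a"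
      using * by fastforce
  qed auto
  then show ?thesis by (simp add: bij_betw_same_card)
qed

text \<open>The product counts \<open>x^2 + 5 y^2 = 6 M\<close> with \<open>M = 4 n + 1\<close>. The
  surviving solutions of \<open>y^2 = M\<close> and \<open>5 y^2 = M\<close> give
  \<open>psi 2\<close> and \<open>q\<close> times \<open>psi 10\<close>.\<close>

lemma eta_1_5_dissection: "eta 1 * eta 5 = eta 2 ^ 3 + fps_X * eta 10 ^ 3"
proof -
  have "eta 1 * eta 5 = psi 2 + fps_X * psi 10"
  proof (rule fps_ext)
    fix n
    let ?I = "{x::int. x mod 6 = 1}" and ?J = "{y::int. y mod 4 = 1}"
    have "eta 5 = eta 1 oo fps_X ^ 5" by (simp add: eta_compose)
    then have eta5: "eta 5 = theta ?I (\<lambda>x. 5 * nat ((x\<^sup>2 - 1) div 24))"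
      unfolding eta_1_conv_mod_6 by (simp add: theta_compose)
    have *: "(nat ((x\<^sup>2 - 1) div 24) + 5 * nat ((y\<^sup>2 - 1) div 24) = n) \<longleftrightarrow> x\<^sup>2 + 5 * y\<^sup>2 = 6 * (4 * int n + 1)"
      if "odd x" "\<not> 3 dvd x" "odd y" "\<not> 3 dvd y" for x y :: int
    proof -
    define a where "a = nat ((x\<^sup>2 - 1) div 24)"
    define b where "b = nat ((y\<^sup>2 - 1) div 24)"
    have "x\<^sup>2 = 24 * int a + 1" "y\<^sup>2 = 24 * int b + 1"
      unfolding a_def b_def by (intro pentagonal_exponent  that)+
    then show ?thesis unfolding a_def[symmetric] b_def[symmetric] by presburger
  qed
    have eta1: "eta 1 = theta ?I (\<lambda>x. 1 * nat ((x\<^sup>2 - 1) div 24))"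
      using eta_1_conv_mod_6 by (simp only: mult_1)
    have fin: "finite {x \<in> ?I. 1 * nat ((x\<^sup>2 - 1) div 24) = n}" "finite {x \<in> ?I. 5 * nat ((x\<^sup>2 - 1) div 24) = n}" for n
      by (rule finite_pentagonal_fibre; simp add: odd_of_mod)+
    have "{p \<in> ?I \<times> ?I. (case p of (x, y) \<Rightarrow> 1 * nat ((x\<^sup>2 - 1) div 24) + 5 * nat ((y\<^sup>2 - 1) div 24)) = n} =
      {(x, y). x mod 6 = 1 \<and> y mod 6 = 1 \<and> x\<^sup>2 + 5 * y\<^sup>2 = 6 * (4 * int n + 1)}"
    proof (rule set_eqI)
      fix p :: "int \<times> int"
      obtain x y where p: "p = (x, y)" by (cases p)
      have "(x mod 6 = 1 \<and> y mod 6 = 1) \<and>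
          1 * nat ((x\<^sup>2 - 1) div 24) + 5 * nat ((y\<^sup>2 - 1) div 24) = n \<longleftrightarrow>
        x mod 6 = 1 \<and> y mod 6 = 1 \<and> x\<^sup>2 + 5 * y\<^sup>2 = 6 * (4 * int n + 1)"
        unfolding mult_1 using *[of x y] odd_of_mod(2,3) by blast
      then show "p \<in> {p \<in> ?I \<times> ?I. (case p of (x, y) \<Rightarrow> 1 * nat ((x\<^sup>2 - 1) div 24) + 5 * nat ((y\<^sup>2 - 1) div 24)) = n}
        \<longleftrightarrow> p \<in> {(x, y). x mod 6 = 1 \<and> y mod 6 = 1 \<and> x\<^sup>2 + 5 * y\<^sup>2 = 6 * (4 * int n + 1)}"
        unfolding p by (simp only: mem_Collect_eq mem_Sigma_iff prod.case)
    qed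
    then have "fps_nth (eta 1 * eta 5) n =
        of_nat (card {(x::int, y). x mod 6 = 1 \<and> y mod 6 = 1 \<and> x\<^sup>2 + 5 * y\<^sup>2 = 6 * (4 * int n + 1)})"
      unfolding eta1 eta5 using fin by (simp only: theta_mult theta_nth)
    also have "\<dots> = of_nat (card {y. y mod 4 = 1 \<and> y\<^sup>2 = 4 * int n + 1}) +
        of_nat (card {y. y mod 4 = 1 \<and> 5 * y\<^sup>2 = 4 * int n + 1})"
      unfolding card_disc20_form_div_6 by (rule card_disc20_form) (simp, presburger)
    also have "{y. y mod 4 = 1 \<and> y\<^sup>2 = 4 * int n + 1} = {y \<in> ?J. 2 * nat ((y\<^sup>2 - 1) div 8) = n}"
    proof -
      have "2 * nat ((y\<^sup>2 - 1) div 8) = n \<longleftrightarrow> y\<^sup>2 = 4 * int n + 1" if "odd y" for y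
        using triangular_exponent[OF that] by (intro iffI; linarith)
      then show ?thesis unfolding mem_Collect_eq using odd_of_mod(1) by (intro Collect_cong) blast
    qed
    also have "{y. y mod 4 = 1 \<and> 5 * y\<^sup>2 = 4 * int n + 1} = {y \<in> ?J. 10 * nat ((y\<^sup>2 - 1) div 8) + 1 = n}"
    proof -
      have "10 * nat ((y\<^sup>2 - 1) div 8) + 1 = n \<longleftrightarrow> 5 * y\<^sup>2 = 4 * int n + 1" if "odd y" for y
        using triangular_exponent[OF that] by (intro iffI; linarith)
      then show ?thesis unfolding mem_Collect_eq using odd_of_mod(1) by (intro Collect_cong) blast
    qed
    also have "(of_nat (card {y \<in> ?J. 10 * nat ((y\<^sup>2 - 1) div 8) + 1 = n}) :: bit) = fps_nth (fps_X * psi 10) n"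
      by (cases n) (simp_all add: psi_def)
    finally show "fps_nth (eta 1 * eta 5) n = fps_nth (psi 2 + fps_X * psi 10) n"
      by (simp add: psi_def)
  qed
  then show ?thesis by (simp add: psi_eq_eta_power3)
qed

text \<open>Index \<open>4 n + 1\<close> turns the exponent equation into one with right side
  \<open>96 n + 32\<close>, to which the halving lemma applies.\<close>

lemma bisect_eta_3_5: "bisect 0 (bisect 1 (eta 3 * eta 5)) = fps_X * (eta 1 * eta 15)\<^sup>2"
proof (rule fps_ext)
  fix n
  have "fps_nth (bisect 0 (bisect 1 (eta 3 * eta 5))) n = fps_nth (eta 3 * eta 5) (4 * n + 1)"
    by simp
  also have "\<dots> = of_nat (card {(X::int, Y). X mod 4 = 1 \<and> \<not> 3 dvd X \<and> Y mod 4 = 1 \<and> \<not> 3 dvd Y \<and>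
      3 * X\<^sup>2 + 5 * Y\<^sup>2 = 96 * int n + 32})"
    by (subst eta_mult_nth) (simp_all add: algebra_simps)
  also have "\<dots> = of_nat (card {(x::int, y). x mod 4 = 1 \<and> \<not> 3 dvd x \<and> y mod 4 = 1 \<and> \<not> 3 dvd y \<and>
      x\<^sup>2 + 15 * y\<^sup>2 = 12 * int n + 4})"
    by (rule card_disc60_form_halving)
  also have "\<dots> = fps_nth (fps_X * (eta 2 * eta 30)) n"
  proof (cases n)
    case 0
    have "x\<^sup>2 + 15 * y\<^sup>2 \<noteq> 4" if "y mod 4 = 1" for x y :: int
    proof -
      have "y \<noteq> 0" using that by auto
      then have "y\<^sup>2 > 0" by simp
      then show ?thesis using zero_le_power2[of x] by linarith
    qed
    then have *: "{(x::int, y). x mod 4 = 1 \<and> \<not> 3 dvd x \<and> y mod 4 = 1 \<and> \<not> 3 dvd y \<and>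
      x\<^sup>2 + 15 * y\<^sup>2 = 12 * int n + 4} = {}" using 0 by auto
    show ?thesis unfolding * using 0 by simp
  next
    case (Suc m)
    \<comment> \<open>Doubling gives the equation of \<open>eta 2 * eta 30\<close> at
      \<open>n - 1\<close>; the shift is the factor \<open>fps_X\<close>.\<close>
    have iff: "x\<^sup>2 + 15 * y\<^sup>2 = 12 * int n + 4 \<longleftrightarrow> 2 * x\<^sup>2 + 30 * y\<^sup>2 = 24 * int m + 2 + 30" for x y
      unfolding Suc of_nat_Suc by presburger
    have "fps_nth (fps_X * (eta 2 * eta 30)) n = fps_nth (eta 2 * eta 30) m" using Suc by simp
    also have "\<dots> = of_nat (card {(x::int, y). x mod 4 = 1 \<and> \<not> 3 dvd x \<and> y mod 4 = 1 \<and> \<not> 3 dvd y \<and>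
        2 * x\<^sup>2 + 30 * y\<^sup>2 = 24 * int m + 2 + 30})"
      unfolding eta_mult_nth[of 2 30 m, simplified] by simp
    finally show ?thesis by (simp only: iff)
  qed
  finally show "fps_nth (bisect 0 (bisect 1 (eta 3 * eta 5))) n = fps_nth (fps_X * (eta 1 * eta 15)\<^sup>2) n"
    by (simp add: power_mult_distrib eta_power2)
qed

lemma eta_2_15_nth: "fps_nth (eta 2 * eta 15) (5 * n + 2) = fps_nth (eta 3 * eta 10) n"
proof -
  have e1: "24 * int (5 * n + 2) + int 2 + int 15 = 5 * (24 * int n + 13)" by simp
  have e2: "24 * int n + int 3 + int 10 = 24 * int n + 13" by simp
  have n2: "int 2 = 2" "int 3 = 3" "int 10 = 10" "int 15 = 15" by simp_all
  show ?thesis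
    by (subst (1 2) eta_mult_nth; simp only: e1 e2; simp only: n2 card_form_2_15; simp)
qed

lemma eta_3_10_nth: "fps_nth (eta 3 * eta 10) (25 * n + 13) = fps_nth (eta 3 * eta 10) n"
proof -
  have e1: "24 * int (25 * n + 13) + int 3 + int 10 = 25 * (24 * int n + 13)" by simp
  have e2: "24 * int n + int 3 + int 10 = 24 * int n + 13" by simp
  have n2: "int 3 = 3" "int 10 = 10" by simp_all
  show ?thesis
    by (subst (1 2) eta_mult_nth; simp only: e1 e2; simp only: n2 card_form_3_10; simp)
qed

section \<open>Dissections\<close>

text \<open>Squaring is additive here, so the product is again of the form
  \<open>a^2 + q b^2\<close>, where \<open>b\<close> collects the cross terms.\<close>

lemma bisect_1_mult:
  "bisect 1 ((p\<^sup>2 + fps_X * q\<^sup>2) * (r\<^sup>2 + fps_X * s\<^sup>2)) = p * s + q * r"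
proof -
  have "(p\<^sup>2 + fps_X * q\<^sup>2) * (r\<^sup>2 + fps_X * s\<^sup>2) = (p * r + fps_X * q * s)\<^sup>2 + fps_X * (p * s + q * r)\<^sup>2"
    unfolding fps_bit_power2_add power_mult_distrib by (simp add: algebra_simps power2_eq_square)
  then show ?thesis by (simp only: bisect_dissected)
qed

lemma fps_compose_X_power_mult:
  fixes f g :: "bit fps"
  assumes "k > 0"
  shows "(f * g) oo fps_X ^ k = (f oo fps_X ^ k) * (g oo fps_X ^ k)"
  using assms by (intro fps_compose_mult_distrib) (simp add: fps_X_power_nth)

lemma eta_power_compose: "k > 0 \<Longrightarrow> eta i ^ m oo fps_X ^ k = eta (k * i) ^ m"
  by (induction m) (simp_all add: fps_compose_X_power_mult eta_compose)

lemma X_compose: "k > 0 \<Longrightarrow> (fps_X :: bit fps) oo fps_X ^ k = fps_X ^ k"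
  by (simp add: fps_X_fps_compose_startby0 fps_X_power_nth)

lemma eta_power_double: "eta (2 * i) ^ m = (eta i ^ m)\<^sup>2"
  unfolding eta_power2[symmetric] by (simp add: power_mult [symmetric] mult.commute)

lemma eta_quadruple_power3: "eta (4 * i) ^ 3 = (eta i ^ 6)\<^sup>2"
  unfolding eta_power4[symmetric] by (simp add: power_mult [symmetric])

text \<open>The second and fourth identities follow from the first and third by replacing
  \<open>q\<close> with \<open>q^3\<close> and \<open>q^5\<close>; the surplus even powers of
  \<open>q\<close> enter the squares.\<close>

lemma dissections:
  shows eta_1_5: "eta 1 * eta 5 = (eta 1 ^ 3)\<^sup>2 + fps_X * (eta 5 ^ 3)\<^sup>2"
    and eta_3_15: "eta 3 * eta 15 = (eta 3 ^ 3)\<^sup>2 + fps_X * (fps_X * eta 15 ^ 3)\<^sup>2"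
    and eta_1_3: "eta 1 ^ 3 * eta 3 ^ 3 = (eta 1 ^ 6)\<^sup>2 + fps_X * (eta 3 ^ 6)\<^sup>2"
    and eta_5_15: "eta 5 ^ 3 * eta 15 ^ 3 = (eta 5 ^ 6)\<^sup>2 + fps_X * (fps_X\<^sup>2 * eta 15 ^ 6)\<^sup>2"
proof -
  show "eta 1 * eta 5 = (eta 1 ^ 3)\<^sup>2 + fps_X * (eta 5 ^ 3)\<^sup>2"
    using eta_1_5_dissection eta_power_double[of 1 3] eta_power_double[of 5 3] by simp
  show "eta 1 ^ 3 * eta 3 ^ 3 = (eta 1 ^ 6)\<^sup>2 + fps_X * (eta 3 ^ 6)\<^sup>2"
    using eta_1_3_dissection eta_quadruple_power3[of 1] eta_quadruple_power3[of 3] by simp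
  have "eta 1 * eta 5 oo fps_X ^ 3 = (eta 2 ^ 3 + fps_X * eta 10 ^ 3) oo fps_X ^ 3"
    by (simp only: eta_1_5_dissection)
  then have "eta 3 * eta 15 = eta 6 ^ 3 + fps_X ^ 3 * eta 30 ^ 3"
    by (simp add: fps_compose_X_power_mult eta_compose eta_power_compose fps_compose_add_distrib X_compose)
  then show "eta 3 * eta 15 = (eta 3 ^ 3)\<^sup>2 + fps_X * (fps_X * eta 15 ^ 3)\<^sup>2"
    using eta_power_double[of 3 3] eta_power_double[of 15 3]
    by (simp add: power_mult_distrib power2_eq_square power3_eq_cube mult.assoc)
  have "eta 1 ^ 3 * eta 3 ^ 3 oo fps_X ^ 5 = (eta 4 ^ 3 + fps_X * eta 12 ^ 3) oo fps_X ^ 5"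
    by (simp only: eta_1_3_dissection)
  then have "eta 5 ^ 3 * eta 15 ^ 3 = eta 20 ^ 3 + fps_X ^ 5 * eta 60 ^ 3"
    by (simp add: fps_compose_X_power_mult eta_compose eta_power_compose fps_compose_add_distrib X_compose)
  also have "fps_X ^ 5 = fps_X * ((fps_X\<^sup>2)\<^sup>2 :: bit fps)" by (simp add: numeral_eq_Suc)
  finally show "eta 5 ^ 3 * eta 15 ^ 3 = (eta 5 ^ 6)\<^sup>2 + fps_X * (fps_X\<^sup>2 * eta 15 ^ 6)\<^sup>2"
    using eta_quadruple_power3[of 5] eta_quadruple_power3[of 15]
    by (simp add: power_mult_distrib mult.assoc)
qed

text \<open>
  Modulo \<open>2\<close>, this says that \<open>q f\<^sub>1 f\<^sub>3 f\<^sub>5 f\<^sub>1\<^sub>5\<close>, the newform of level \<open>15\<close>, is fixed by \<open>U\<^sub>2\<close>.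
  Dissecting \<open>G\<close> as \<open>(f\<^sub>1 f\<^sub>5) (f\<^sub>3 f\<^sub>1\<^sub>5)\<close> and \<open>G\<^sup>3\<close> as \<open>(f\<^sub>1 f\<^sub>3)\<^sup>3 (f\<^sub>5 f\<^sub>1\<^sub>5)\<^sup>3\<close> shows that the
  odd part \<open>J\<close> of \<open>G\<close> satisfies \<open>G J = J\<^sup>2\<close>.
\<close>

lemma bisect_1_newform:
  "bisect 1 (eta 1 * eta 3 * eta 5 * eta 15) = eta 1 * eta 3 * eta 5 * eta 15"
proof -
  define G where "G = eta 1 * eta 3 * eta 5 * eta 15"
  define J where "J = eta 3 ^ 3 * eta 5 ^ 3 + fps_X * eta 1 ^ 3 * eta 15 ^ 3"
  have G: "G = (eta 1 * eta 5) * (eta 3 * eta 15)" by (simp add: G_def mult_ac)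
  have "bisect 1 G = eta 1 ^ 3 * (fps_X * eta 15 ^ 3) + eta 5 ^ 3 * eta 3 ^ 3"
    unfolding G eta_1_5 eta_3_15 bisect_1_mult ..
  then have GJ: "bisect 1 G = J" by (simp add: J_def mult_ac add.commute)
  have G3: "G\<^sup>2 * G = (eta 1 ^ 3 * eta 3 ^ 3) * (eta 5 ^ 3 * eta 15 ^ 3)"
    by (simp add: G_def power2_eq_square power3_eq_cube mult_ac)
  have "bisect 1 (G\<^sup>2 * G) = eta 1 ^ 6 * (fps_X\<^sup>2 * eta 15 ^ 6) + eta 3 ^ 6 * eta 5 ^ 6"
    unfolding G3 eta_1_3 eta_5_15 bisect_1_mult ..
  also have "\<dots> = J\<^sup>2"
    unfolding J_def fps_bit_power2_add power_mult_distrib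
    by (simp add: power_mult [symmetric] mult_ac add.commute)
  \<comment> \<open>The square leaves \<open>bisect 1 (G^2 * G)\<close> as \<open>G\<close>, the
    remaining factor being \<open>bisect 1 G = J\<close>.\<close>
  finally have "G * J = J * J"
    unfolding bisect_square_mult GJ by (simp add: power2_eq_square)
  moreover have "J \<noteq> 0"
  proof
    assume "J = 0"
    then have "fps_nth J 0 = 0" by simp
    then show False by (simp add: J_def eta_nth_0 fps_power_zeroth)
  qed
  ultimately have "G = J" by simp
  then show ?thesis using GJ by (simp add: G_def)
qed

text \<open>The equation is kept free of division: before each bisection the cofactor of
  \<open>B\<close> is a square, and common factors are cancelled afterwards. The bisections 1, 1, 0,
  0 select the indices \<open>16 n + 3\<close>.\<close>

lemma bisect_quotient:
  assumes B: "B * (eta 1 * eta 15 * eta 24 * eta 40 * eta 120) = eta 3 * eta 5 * eta 8"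
  shows "bisect 0 (bisect 0 (bisect 1 (bisect 1 B))) = fps_X * (eta 2 * eta 15)"
proof -
  let ?E = "eta 3 * eta 5" and ?F = "eta 1 * eta 15" and ?D = "eta 3 * eta 5 * eta 15"
  have nz: "eta 1 \<noteq> 0" "?F \<noteq> 0" "?D \<noteq> 0" by (simp_all add: eta_neq_0)
  have pow8: "eta (8 * i) = ((eta i ^ 2)\<^sup>2)\<^sup>2" for i
    using eta_power2[of i] eta_power2[of "2 * i"] eta_power2[of "4 * i"] by simp
  \<comment> \<open>The extra factor \<open>?F\<close> completes the cofactor to a square and turns
    \<open>?E\<close> into the newform product, which bisection fixes.\<close>
  have "(?F * (?D\<^sup>2)\<^sup>2)\<^sup>2 * B = ?F * (?F * ((?D\<^sup>2)\<^sup>2)\<^sup>2 * B)"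
    by (simp add: power_mult_distrib power2_eq_square mult_ac)
  also have "?F * ((?D\<^sup>2)\<^sup>2)\<^sup>2 * B = B * (eta 1 * eta 15 * eta 24 * eta 40 * eta 120)"
    using pow8[of 3] pow8[of 5] pow8[of 15] by (simp add: power_mult_distrib mult_ac)
  also have "?F * \<dots> = (((eta 1)\<^sup>2)\<^sup>2)\<^sup>2 * (eta 1 * eta 3 * eta 5 * eta 15)"
    unfolding B using pow8[of 1] by (simp add: mult_ac)
  finally have "?F * (?D\<^sup>2)\<^sup>2 * bisect 1 B = ((eta 1)\<^sup>2)\<^sup>2 * (eta 1 * eta 3 * eta 5 * eta 15)"
    by (metis bisect_square_mult(2) bisect_1_newform)
  then have "?F * ((?D\<^sup>2)\<^sup>2 * bisect 1 B) = ?F * (((eta 1)\<^sup>2)\<^sup>2 * ?E)"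
    by (simp only: mult_ac)
  then have "(?D\<^sup>2)\<^sup>2 * bisect 1 B = ((eta 1)\<^sup>2)\<^sup>2 * ?E"
    using nz(2) mult_left_cancel by blast
  then have "?D\<^sup>2 * bisect 1 (bisect 1 B) = (eta 1)\<^sup>2 * bisect 1 ?E"
    by (metis bisect_square_mult(2))
  then have *: "?D * bisect 0 (bisect 1 (bisect 1 B)) = eta 1 * (fps_X * ?F\<^sup>2)"
    by (metis bisect_square_mult(1) bisect_eta_3_5)
  \<comment> \<open>The extra factor \<open>?D\<close> has the same double purpose:
    \<open>eta 1 * ?D\<close> is again the newform product.\<close>
  have "?D\<^sup>2 * bisect 0 (bisect 1 (bisect 1 B)) = ?D * (?D * bisect 0 (bisect 1 (bisect 1 B)))"
    by (simp only: power2_eq_square mult_ac)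
  also have "\<dots> = ?F\<^sup>2 * (fps_X * (eta 1 * eta 3 * eta 5 * eta 15))"
    unfolding * by (simp only: mult_ac)
  finally have "?D * bisect 0 (bisect 0 (bisect 1 (bisect 1 B))) =
      ?F * bisect 0 (fps_X * (eta 1 * eta 3 * eta 5 * eta 15))"
    by (metis bisect_square_mult(1))
  also have "bisect 0 (fps_X * (eta 1 * eta 3 * eta 5 * eta 15)) = fps_X * (eta 1 * eta 3 * eta 5 * eta 15)"
    by (simp only: bisect_0_X_mult bisect_1_newform)
  also have "?F * (fps_X * (eta 1 * eta 3 * eta 5 * eta 15)) = ?D * (fps_X * ((eta 1)\<^sup>2 * eta 15))"
    by (simp only: power2_eq_square mult_ac)
  finally show ?thesis
    using nz(3) mult_left_cancel eta_power2[of 1] by (metis mult_1_right)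
qed

section \<open>The pentagonal number theorem\<close>

definition qpoch :: "nat \<Rightarrow> 'a::comm_ring_1 fps" where
  "qpoch n = (\<Prod>k<n. 1 - fps_X ^ Suc k)"

text \<open>The infinite product, taken diagonally: the factors beyond the first \<open>n\<close> do
  not affect coefficient \<open>n\<close>.\<close>

definition euler :: "'a::comm_ring_1 fps" where
  "euler = Abs_fps (\<lambda>n. fps_nth (qpoch n) n)"

lemma qpoch_nth_stable:
  assumes "n \<le> N"
  shows "fps_nth (qpoch N :: 'a::comm_ring_1 fps) n = fps_nth (euler :: 'a fps) n"
  using assms
proof (induction N rule: dec_induct)
  case base
  then show ?case by (simp add: euler_def)
next
  case (step m)
  have "(qpoch (Suc m) :: 'a fps) = qpoch m - fps_X ^ Suc m * qpoch m"
    by (simp add: qpoch_def algebra_simps)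
  then show ?case using step by (simp add: fps_X_power_mult_nth del: power_Suc)
qed

text \<open>The finite form of the pentagonal number theorem due to D. Shanks (1951).\<close>

lemma shanks:
  fixes q :: "'a::comm_ring_1"
  shows "(\<Sum>s\<le>n. (-1) ^ s * (\<Prod>k=s..<n. 1 - q ^ Suc k) * q ^ (n * s + triangle s)) =
    1 + (\<Sum>s<n. (-1) ^ Suc s * (q ^ (Suc s * Suc s + triangle s) + q ^ (Suc s * Suc s + triangle (Suc s))))"
proof (induction n)
  case (Suc n)
  define D where "D s = (\<Prod>k=s..<n. 1 - q ^ Suc k)" for s
  \<comment> \<open>A telescoping certificate: from \<open>n\<close> to \<open>n + 1\<close> the
    summand \<open>s\<close> changes by \<open>c (Suc s) - c s\<close>. The value 0 at
    \<open>s = 0\<close> agrees with the factor \<open>1 - q ^ s\<close> of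
    \<open>c s\<close>.\<close>
  define c where "c = (\<lambda>s. case s of 0 \<Rightarrow> 0 | Suc r \<Rightarrow> (-1) ^ Suc r * D r * q ^ (Suc n * Suc r + triangle r))"
  have D: "(\<Prod>k=s..<Suc n. 1 - q ^ Suc k) = D s * (1 - q ^ Suc n)" if "s \<le> n" for s
    using that by (simp add: D_def)
  have step: "(-1) ^ s * (D s * (1 - q ^ Suc n)) * q ^ (Suc n * s + triangle s) =
      (-1) ^ s * D s * q ^ (n * s + triangle s) + (c (Suc s) - c s)" if "s \<le> n" for s
  proof -
    have "c s = (-1) ^ s * D s * (1 - q ^ s) * q ^ (n * s + triangle s)"
    proof (cases s)
      case (Suc r)
      have Dr: "D r = (1 - q ^ Suc r) * D (Suc r)"
        using that Suc unfolding D_def by (simp add: prod.atLeast_Suc_lessThan)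
      have exponent: "Suc n * Suc r + triangle r = n * Suc r + triangle (Suc r)"
        by (simp add: triangle_Suc)
      show ?thesis unfolding Suc c_def nat.case exponent Dr by (simp only: mult_ac)
    qed (simp add: c_def)
    moreover have "c (Suc s) = - ((-1) ^ s * D s * (q ^ (n * s + triangle s) * q ^ s * q ^ Suc n))"
    proof -
      have "Suc n * Suc s + triangle s = (n * s + triangle s) + s + Suc n" by simp
      then show ?thesis unfolding c_def by (simp add: power_add mult_ac)
    qed
    moreover have "q ^ (Suc n * s + triangle s) = q ^ (n * s + triangle s) * q ^ s"
      by (simp add: power_add mult_ac)
    ultimately show ?thesis by (simp add: algebra_simps)
  qed
  have "(\<Sum>s\<le>n. (-1) ^ s * (\<Prod>k=s..<Suc n. 1 - q ^ Suc k) * q ^ (Suc n * s + triangle s)) =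
      (\<Sum>s\<le>n. (-1) ^ s * D s * q ^ (n * s + triangle s) + (c (Suc s) - c s))"
    using D step by (intro sum.cong) auto
  also have "\<dots> = (\<Sum>s\<le>n. (-1) ^ s * D s * q ^ (n * s + triangle s)) + (c (Suc n) - c 0)"
    by (simp only: sum.distrib lessThan_Suc_atMost[symmetric] sum_lessThan_telescope)
  \<comment> \<open>This boundary term is the first of the two new powers; the second is the summand
    \<open>s = n + 1\<close>.\<close>
  also have "c (Suc n) - c 0 = (-1) ^ Suc n * q ^ (Suc n * Suc n + triangle n)"
    by (simp add: c_def D_def)
  finally have "(\<Sum>s\<le>Suc n. (-1) ^ s * (\<Prod>k=s..<Suc n. 1 - q ^ Suc k) * q ^ (Suc n * s + triangle s)) =
      (\<Sum>s\<le>n. (-1) ^ s * D s * q ^ (n * s + triangle s)) + (-1) ^ Suc n * q ^ (Suc n * Suc n + triangle n)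
      + (-1) ^ Suc n * q ^ (Suc n * Suc n + triangle (Suc n))"
    by simp
  then show ?case using Suc.IH by (simp add: D_def algebra_simps)
qed simp

text \<open>With \<open>j = s + 1\<close> the two exponents are \<open>j (3 j - 1) / 2\<close> and
  \<open>j (3 j + 1) / 2\<close>, the values of \<open>k (3 k + 1) / 2\<close> at \<open>- j\<close>
  and \<open>j\<close>. Signs disappear in characteristic 2.\<close>

lemma shanks_int_sum:
  fixes q :: "bit fps"
  shows "1 + (\<Sum>s<n. (-1) ^ Suc s * (q ^ (Suc s * Suc s + triangle s) + q ^ (Suc s * Suc s + triangle (Suc s)))) =
    (\<Sum>k\<in>{- int n..int n}. q ^ nat (k * (3 * k + 1) div 2))"
proof (induction n)
  case (Suc n)
  have minus: "- f = f" for f :: "bit fps"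
    using fps_bit_add_self[of f] by (metis add_eq_0_iff)
  have sgn: "(-1) ^ m = (1 :: bit fps)" for m
    by (simp add: minus)
  define j where "j = int (Suc n)"
  have e1: "nat (- j * (3 * (- j) + 1) div 2) = Suc n * Suc n + triangle n"
  proof -
    have "- j * (3 * (- j) + 1) = int (2 * (Suc n * Suc n) + n * Suc n)"
      by (simp add: j_def algebra_simps)
    also have "\<dots> div 2 = int (Suc n * Suc n + triangle n)"
      unfolding triangle_def by (metis div_mult_self4 nat_int zdiv_int of_nat_numeral zero_neq_numeral add.commute)
    finally show ?thesis by (simp only: nat_int)
  qed
  have e2: "nat (j * (3 * j + 1) div 2) = Suc n * Suc n + triangle (Suc n)"
  proof -
    have "j * (3 * j + 1) = int (2 * (Suc n * Suc n) + Suc n * Suc (Suc n))"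
      by (simp add: j_def algebra_simps)
    also have "\<dots> div 2 = int (Suc n * Suc n + triangle (Suc n))"
      unfolding triangle_def by (metis div_mult_self4 nat_int zdiv_int of_nat_numeral zero_neq_numeral add.commute)
    finally show ?thesis by (simp only: nat_int)
  qed
  have "{- int (Suc n)..int (Suc n)} = insert (- j) (insert j {- int n..int n})"
    by (auto simp: j_def)
  then have "(\<Sum>k\<in>{- int (Suc n)..int (Suc n)}. q ^ nat (k * (3 * k + 1) div 2)) =
      q ^ nat (- j * (3 * (- j) + 1) div 2) + (q ^ nat (j * (3 * j + 1) div 2) +
      (\<Sum>k\<in>{- int n..int n}. q ^ nat (k * (3 * k + 1) div 2)))"
    by (simp add: j_def)
  then show ?case
    unfolding e1 e2 sum.lessThan_Suc Suc.IH[symmetric] sgn by (simp add: algebra_simps)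
qed simp

text \<open>Coefficient \<open>n\<close> is read off the finite identity of length \<open>n\<close>,
  and \<open>x = 6 k + 1\<close> matches its exponents with those of \<open>eta 1\<close>.\<close>

lemma euler_bit: "(euler :: bit fps) = eta 1"
proof (rule fps_ext)
  fix n
  have "(\<Sum>s\<le>n. (-1) ^ s * (\<Prod>k=s..<n. 1 - fps_X ^ Suc k) * fps_X ^ (n * s + triangle s)) =
      (\<Sum>k\<in>{- int n..int n}. (fps_X :: bit fps) ^ nat (k * (3 * k + 1) div 2))"
    unfolding shanks shanks_int_sum ..
  moreover have "fps_nth (\<Sum>s\<le>n. (-1) ^ s * (\<Prod>k=s..<n. 1 - (fps_X :: bit fps) ^ Suc k) * fps_X ^ (n * s + triangle s)) n
      = fps_nth (qpoch n :: bit fps) n"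
  proof -
    \<comment> \<open>The exponent \<open>n * s + triangle s\<close> exceeds \<open>n\<close> as
      soon as \<open>s > 0\<close>, so only \<open>qpoch n\<close> contributes.\<close>
    have "fps_nth ((-1) ^ s * (\<Prod>k=s..<n. 1 - (fps_X :: bit fps) ^ Suc k) * fps_X ^ (n * s + triangle s)) n = 0"
      if s: "s > 0" for s
    proof -
      obtain r where "s = Suc r" using s by (cases s) auto
      then have "n < n * s + triangle s" by (simp add: triangle_Suc)
      then show ?thesis by (simp add: fps_X_power_mult_right_nth)
    qed
    then have "(\<Sum>s\<le>n. fps_nth ((-1) ^ s * (\<Prod>k=s..<n. 1 - (fps_X :: bit fps) ^ Suc k) * fps_X ^ (n * s + triangle s)) n)
        = (\<Sum>s\<in>{0}. fps_nth ((-1) ^ s * (\<Prod>k=s..<n. 1 - (fps_X :: bit fps) ^ Suc k) * fps_X ^ (n * s + triangle s)) n)"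
      by (intro sum.mono_neutral_right) auto
    then show ?thesis by (simp add: fps_sum_nth qpoch_def atLeast0LessThan)
  qed
  ultimately have "fps_nth (euler :: bit fps) n =
      (\<Sum>k\<in>{- int n..int n}. fps_nth ((fps_X :: bit fps) ^ nat (k * (3 * k + 1) div 2)) n)"
    by (simp add: euler_def fps_sum_nth)
  also have "\<dots> = (\<Sum>k\<in>{- int n..int n}. of_bool (nat (k * (3 * k + 1) div 2) = n))"
    by (intro sum.cong) (auto simp: fps_X_power_nth)
  also have "\<dots> = of_nat (card {k \<in> {- int n..int n}. nat (k * (3 * k + 1) div 2) = n})"
    by (simp add: Int_def)
  also have "card {k \<in> {- int n..int n}. nat (k * (3 * k + 1) div 2) = n} =
      card {x::int. x mod 6 = 1 \<and> nat ((x\<^sup>2 - 1) div 24) = n}"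
  proof (rule bij_betw_same_card[of "\<lambda>k. 6 * k + 1"])
    have e: "((6 * k + 1)\<^sup>2 - 1) div 24 = k * (3 * k + 1) div 2" for k :: int
    proof -
      have "(6 * k + 1)\<^sup>2 - 1 = 12 * (k * (3 * k + 1))" by (simp add: power2_eq_square algebra_simps)
      also have "\<dots> div 24 = k * (3 * k + 1) div 2"
        using div_mult_mult1[of 12 "k * (3 * k + 1)" 2] by simp
      finally show ?thesis .
    qed
    \<comment> \<open>This bound ensures that the finite range from \<open>- n\<close> to
      \<open>n\<close> contains every \<open>k\<close> with exponent \<open>n\<close>.\<close>
    have bound: "\<bar>k\<bar> \<le> k * (3 * k + 1) div 2" for k :: int
    proof -
      have "2 * \<bar>k\<bar> \<le> k * (3 * k + 1)"
      proof (cases "k \<ge> 0")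
        case True
        have "2 * k \<le> k * (3 * k + 1)" using True by (cases "k = 0") (auto intro!: mult_left_mono simp: mult.commute[of 2])
        then show ?thesis using True by simp
      next
        case False
        have "- k * 2 \<le> - k * (- 3 * k - 1)" using False by (intro mult_left_mono) auto
        then show ?thesis using False by (simp add: algebra_simps)
      qed
      then show ?thesis by linarith
    qed
    show "bij_betw (\<lambda>k. 6 * k + 1) {k \<in> {- int n..int n}. nat (k * (3 * k + 1) div 2) = n}
        {x::int. x mod 6 = 1 \<and> nat ((x\<^sup>2 - 1) div 24) = n}"
    proof (rule bij_betw_byWitness[where f' = "\<lambda>x. x div 6"])
      show "(\<lambda>k. 6 * k + 1) ` {k \<in> {- int n..int n}. nat (k * (3 * k + 1) div 2) = n} \<subseteq>
          {x::int. x mod 6 = 1 \<and> nat ((x\<^sup>2 - 1) div 24) = n}"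
      proof -
        have "(6 * k + 1) mod 6 = 1" for k :: int by presburger
        then show ?thesis by (simp add: image_subset_iff e)
      qed
      show "(\<lambda>x. x div 6) ` {x::int. x mod 6 = 1 \<and> nat ((x\<^sup>2 - 1) div 24) = n} \<subseteq>
          {k \<in> {- int n..int n}. nat (k * (3 * k + 1) div 2) = n}"
      proof clarify
        fix x :: int assume x: "x mod 6 = 1" "n = nat ((x\<^sup>2 - 1) div 24)"
        define k where "k = x div 6"
        have k: "x = 6 * k + 1" using x(1) by (simp add: k_def) presburger
        have n: "n = nat (k * (3 * k + 1) div 2)" using x(2) unfolding k e .
        have "0 \<le> k * (3 * k + 1) div 2" using bound[of k] by linarith
        then have "int n = k * (3 * k + 1) div 2" unfolding n by (rule nat_0_le)
        then have "\<bar>k\<bar> \<le> int n" using bound[of k] by simp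
        then show "x div 6 \<in> {- int (nat ((x\<^sup>2 - 1) div 24))..int (nat ((x\<^sup>2 - 1) div 24))} \<and>
            nat (x div 6 * (3 * (x div 6) + 1) div 2) = nat ((x\<^sup>2 - 1) div 24)"
          unfolding x(2)[symmetric] k_def[symmetric] n[symmetric] by auto
      qed
      show "\<forall>x\<in>{x::int. x mod 6 = 1 \<and> nat ((x\<^sup>2 - 1) div 24) = n}. 6 * (x div 6) + 1 = x"
      proof clarify
        fix x :: int assume "x mod 6 = 1"
        then show "6 * (x div 6) + 1 = x" using mult_div_mod_eq[of 6 x] by simp
      qed
    qed auto
  qed
  finally show "fps_nth (euler :: bit fps) n = fps_nth (eta 1) n"
    unfolding eta_1_conv_mod_6 by simp
qed

section \<open>The generating function\<close>

text \<open>Coefficientwise image of an integer series, used both for the complex expansions and for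
  reduction modulo 2.\<close>

definition fps_of_int :: "int fps \<Rightarrow> 'a::comm_ring_1 fps" where
  "fps_of_int f = Abs_fps (\<lambda>n. of_int (fps_nth f n))"

lemma fps_of_int_nth [simp]: "fps_nth (fps_of_int f) n = of_int (fps_nth f n)"
  by (simp add: fps_of_int_def)

lemma fps_of_int_mult: "fps_of_int (f * g) = fps_of_int f * fps_of_int g"
  by (rule fps_ext) (simp add: fps_mult_nth)

lemma fps_of_int_compose_X_power:
  "i > 0 \<Longrightarrow> fps_of_int (f oo fps_X ^ i) = fps_of_int f oo fps_X ^ i"
  by (rule fps_ext) (simp add: fps_nth_compose_X_power)

lemma fps_of_int_qpoch: "fps_of_int (qpoch n) = qpoch n"
proof (induction n)
  case 0
  show ?case by (rule fps_ext) (simp add: qpoch_def)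
next
  case (Suc n)
  have "fps_of_int (1 - fps_X ^ Suc n) = (1 - fps_X ^ Suc n :: 'a fps)"
    by (rule fps_ext) (simp add: fps_X_power_nth del: power_Suc)
  then show ?case using Suc unfolding qpoch_def by (simp add: fps_of_int_mult del: power_Suc)
qed

lemma fps_of_int_euler: "fps_of_int euler = euler"
  by (rule fps_ext) (simp add: euler_def flip: fps_of_int_qpoch[where 'a = 'a])

lemma fps_of_int_complex_inject:
  "fps_of_int f = (fps_of_int g :: complex fps) \<Longrightarrow> f = g"
  by (simp add: fps_eq_iff)

text \<open>Taylor coefficients pass to locally uniform limits, and those of the partial products
  are eventually constant.\<close>

lemma f_prod_1_has_fps_expansion: "f_prod 1 has_fps_expansion euler"
proof -
  let ?P = "\<lambda>N q. \<Prod>m<N. 1 - q ^ (1 * Suc m) :: complex"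
  have P: "?P N has_fps_expansion qpoch N" for N
  proof (induction N)
    case 0
    have "(\<lambda>q::complex. 1) has_fps_expansion 1" by simp
    then show ?case by (simp add: qpoch_def)
  next
    case (Suc N)
    have "(\<lambda>q::complex. ?P N q * (1 - q ^ Suc N)) has_fps_expansion qpoch N * (1 - fps_X ^ Suc N)"
      by (intro has_fps_expansion_mult Suc fps_expansion_intros)
    then show ?case by (simp add: qpoch_def del: power_Suc)
  qed
  have "fps_nth (fps_expansion (f_prod 1) 0) n = fps_nth euler n" for n
  proof -
    have "uniform_limit (ball 0 (1/2)) ?P (f_prod 1) sequentially"
      by (rule uniform_limit_on_subset[OF f_prod_uniform_limit[of 1 "1/2"]]) auto
    then have "(\<lambda>N. (deriv ^^ n) (?P N) 0) \<longlonglongrightarrow> (deriv ^^ n) (f_prod 1) 0"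
    proof (rule higher_deriv_complex_uniform_limit)
      show "\<forall>\<^sub>F N in sequentially. ?P N holomorphic_on ball 0 (1/2)"
        by (intro always_eventually allI holomorphic_intros)
    qed auto
    then have "(\<lambda>N. (deriv ^^ n) (?P N) 0 / fact n) \<longlonglongrightarrow> (deriv ^^ n) (f_prod 1) 0 / fact n"
      by (rule tendsto_divide[OF _ tendsto_const]) simp
    moreover have "(\<lambda>N. (deriv ^^ n) (?P N) 0 / fact n) \<longlonglongrightarrow> fps_nth euler n"
    proof (rule tendsto_eventually)
      show "\<forall>\<^sub>F N in sequentially. (deriv ^^ n) (?P N) 0 / fact n = fps_nth euler n"
        using eventually_ge_at_top[of n]
      proof eventually_elim
        case (elim N)
        then show ?case using qpoch_nth_stable[OF elim, where 'a = complex] fps_nth_fps_expansion[OF P, of N n] by simp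
      qed
    qed
    ultimately show ?thesis by (simp add: fps_expansion_def LIMSEQ_unique)
  qed
  then have "fps_expansion (f_prod 1) 0 = euler" by (rule fps_ext)
  then show ?thesis using int_expansion_fps(1)[OF int_expansion_f_prod[of 1]] by simp
qed

lemma f_prod_has_fps_expansion:
  assumes "i > 0"
  shows "f_prod i has_fps_expansion (euler oo fps_X ^ i)"
proof -
  have "f_prod i = f_prod 1 \<circ> (\<lambda>q. q ^ i)"
    by (simp only: fun_eq_iff f_prod_def o_def mult_1 flip: power_mult) simp
  moreover have "(f_prod 1 \<circ> (\<lambda>q. q ^ i)) has_fps_expansion (euler oo fps_X ^ i)"
    by (intro has_fps_expansion_compose f_prod_1_has_fps_expansion fps_expansion_intros)
       (use assms in \<open>simp add: fps_X_power_nth\<close>)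
  ultimately show ?thesis by simp
qed

lemma f_prod_nonzero:
  assumes "i > 0" "norm q < 1"
  shows "f_prod i q \<noteq> 0"
  using int_expansion_f_prod[OF assms(1)] assms(2) by (simp add: int_expansion_def)

text \<open>The generating function with denominators cleared. It is verified on complex expansions
  and pulled back to the integers, whence it can be reduced modulo 2.\<close>

lemma b_coeff_fps:
  fixes l k r :: nat
  assumes "l > 0" "k > 0" "r > 0"
  defines "f \<equiv> \<lambda>i. euler oo fps_X ^ i :: int fps"
  shows "Abs_fps (b_coeff l k r) * (f 1 * f (l * k) * f (l * r) * f (k * r) * f (l * k * r)) = f l * f k * f r"
proof (rule fps_of_int_complex_inject)
  let ?B = "Abs_fps (b_coeff l k r)"
  have F: "f_prod i has_fps_expansion fps_of_int (f i)" if "i > 0" for i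
    using f_prod_has_fps_expansion[OF that] that
    by (simp add: f_def fps_of_int_compose_X_power fps_of_int_euler)
  have "b_gen l k r has_fps_expansion fps_of_int ?B"
    by (rule has_fps_expansionI)
       (use b_coeff_sums[OF assms(1-3)] in \<open>auto simp: eventually_nhds_metric intro!: exI[of _ 1]\<close>)
  then have "(\<lambda>q. b_gen l k r q * (f_prod 1 q * f_prod (l * k) q * f_prod (l * r) q * f_prod (k * r) q * f_prod (l * k * r) q))
      has_fps_expansion fps_of_int (?B * (f 1 * f (l * k) * f (l * r) * f (k * r) * f (l * k * r)))"
    unfolding fps_of_int_mult by (intro has_fps_expansion_mult F) (use assms in simp_all)
  also have "?this \<longleftrightarrow> (\<lambda>q. f_prod l q * f_prod k q * f_prod r q)
      has_fps_expansion fps_of_int (?B * (f 1 * f (l * k) * f (l * r) * f (k * r) * f (l * k * r)))"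
  proof (rule has_fps_expansion_cong)
    \<comment> \<open>The denominator does not vanish in the unit disc, a neighbourhood of 0, which
      suffices for equal expansions.\<close>
    have "b_gen l k r q * (f_prod 1 q * f_prod (l * k) q * f_prod (l * r) q * f_prod (k * r) q * f_prod (l * k * r) q)
        = f_prod l q * f_prod k q * f_prod r q" if "norm q < 1" for q
      using that assms by (simp add: b_gen_def f_prod_nonzero)
    then show "\<forall>\<^sub>F q in nhds 0. b_gen l k r q * (f_prod 1 q * f_prod (l * k) q * f_prod (l * r) q * f_prod (k * r) q * f_prod (l * k * r) q)
        = f_prod l q * f_prod k q * f_prod r q"
      by (auto simp: eventually_nhds_metric intro!: exI[of _ 1])
  qed simp
  finally have "(\<lambda>q. f_prod l q * f_prod k q * f_prod r q)
      has_fps_expansion fps_of_int (?B * (f 1 * f (l * k) * f (l * r) * f (k * r) * f (l * k * r)))" .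
  moreover have "(\<lambda>q. f_prod l q * f_prod k q * f_prod r q) has_fps_expansion fps_of_int (f l * f k * f r)"
    unfolding fps_of_int_mult by (intro has_fps_expansion_mult F) (use assms in simp_all)
  ultimately show "fps_of_int (?B * (f 1 * f (l * k) * f (l * r) * f (k * r) * f (l * k * r))) = (fps_of_int (f l * f k * f r) :: complex fps)"
    by (rule fps_expansion_unique_complex)
qed

lemma b_coeff_16_mod_2: "of_int (b_coeff 3 5 8 (16 * n + 3)) = fps_nth (fps_X * (eta 2 * eta 15)) n"
proof -
  let ?B = "fps_of_int (Abs_fps (b_coeff 3 5 8)) :: bit fps"
  define f where "f = (\<lambda>i. euler oo fps_X ^ i :: int fps)"
  have eta: "fps_of_int (f i) = eta i" if "i > 0" for i
    using that by (simp add: f_def fps_of_int_compose_X_power fps_of_int_euler euler_bit eta_compose)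
  have "fps_of_int (Abs_fps (b_coeff 3 5 8) * (f 1 * f 15 * f 24 * f 40 * f 120)) = (fps_of_int (f 3 * f 5 * f 8) :: bit fps)"
    using b_coeff_fps[of 3 5 8] by (simp add: f_def)
  then have "?B * (eta 1 * eta 15 * eta 24 * eta 40 * eta 120) = eta 3 * eta 5 * eta 8"
    by (simp only: fps_of_int_mult eta zero_less_numeral zero_less_one)
  note bisect_quotient[OF this]
  moreover have "fps_nth (bisect 0 (bisect 0 (bisect 1 (bisect 1 ?B)))) n = fps_nth ?B (16 * n + 3)"
    unfolding bisect_nth by (rule arg_cong[where f = "fps_nth ?B"]) simp
  ultimately show ?thesis by simp
qed

section \<open>The congruence\<close>

lemma bit_of_int_eq_iff: "(of_int a :: bit) = of_int b \<longleftrightarrow> [a = b] (mod 2)"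
proof -
  have "(of_int c :: bit) = of_bool (odd c)" for c
    by (cases "even c") (auto elim!: evenE oddE)
  then show ?thesis by (auto simp: cong_def) presburger+
qed

lemma b_coeff_80_mod_2: "of_int (b_coeff 3 5 8 (80 * n + 51)) = fps_nth (eta 3 * eta 10) n"
proof -
  \<comment> \<open>The factor \<open>fps_X\<close> lowers the index \<open>5 n + 3\<close> to
    \<open>5 n + 2\<close>.\<close>
  have "80 * n + 51 = 16 * (5 * n + 3) + 3" "5 * n + 3 = Suc (5 * n + 2)" by simp_all
  then have "(of_int (b_coeff 3 5 8 (80 * n + 51)) :: bit) = fps_nth (fps_X * (eta 2 * eta 15)) (Suc (5 * n + 2))"
    by (simp only: b_coeff_16_mod_2)
  also have "\<dots> = fps_nth (eta 2 * eta 15) (5 * n + 2)" by simp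
  finally show ?thesis by (simp only: eta_2_15_nth)
qed

theorem theorem1p6:
  fixes n k :: nat
  shows "[b_coeff 3 5 8 (16 * 5 ^ (2 * k + 1) * n + (26 * 5 ^ (2 * k + 1) + 23) div 3)
          = b_coeff 3 5 8 (80 * n + 51)] (mod 2)"
proof -
  \<comment> \<open>Each step of \<open>k\<close> keeps the index of the form
    \<open>80 m + 51\<close> and replaces \<open>m\<close> by \<open>25 m + 13\<close>.\<close>
  have "\<exists>m. 16 * 5 ^ (2 * k + 1) * n + (26 * 5 ^ (2 * k + 1) + 23) div 3 = 80 * m + 51 \<and>
      fps_nth (eta 3 * eta 10) m = fps_nth (eta 3 * eta 10) n"
  proof (induction k)
    case 0
    show ?case by (rule exI[of _ n]) simp
  next
    case (Suc k)
    define a where "a = (5 :: nat) ^ (2 * k + 1)"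
    obtain m where m: "16 * a * n + (26 * a + 23) div 3 = 80 * m + 51"
      "fps_nth (eta 3 * eta 10) m = fps_nth (eta 3 * eta 10) n"
      using Suc unfolding a_def by blast
    obtain d where d: "26 * a + 23 = 3 * d" using three_dvd[of k] unfolding a_def by blast
    \<comment> \<open>The whole index passes from \<open>N\<close> to \<open>25 N - 184\<close>,
      where \<open>3 * 184 = 24 * 23\<close>; this also takes \<open>80 m + 51\<close> to
      \<open>80 (25 m + 13) + 51\<close>.\<close>
    have "26 * (25 * a) + 23 = 3 * (25 * d - 184)" using d by simp
    then have "16 * (25 * a) * n + (26 * (25 * a) + 23) div 3 = 80 * (25 * m + 13) + 51"
      using m(1) d by simp
    moreover have "5 ^ (2 * Suc k + 1) = 25 * a" by (simp add: a_def)
    ultimately show ?case using m(2) by (intro exI[of _ "25 * m + 13"]) (simp only: eta_3_10_nth)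
  qed
  then obtain m where "16 * 5 ^ (2 * k + 1) * n + (26 * 5 ^ (2 * k + 1) + 23) div 3 = 80 * m + 51"
    "fps_nth (eta 3 * eta 10) m = fps_nth (eta 3 * eta 10) n" by blast
  then show ?thesis
    unfolding bit_of_int_eq_iff[symmetric] by (simp only: b_coeff_80_mod_2)
qed

end
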